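(* Let $\rho>1$, let $u\in\mathcal A_\rho$, let $\alpha,\beta>-1$ and let $n\ge 0$ be an integer. Put $M=\max_{z\in\mathcal E_\rho}|u(z)|$. Then $$ \big|\hat u_n^{\alpha,\beta}\big|\le\frac{M}{\rho^{n}}\bigg[\big|\sigma_{n,0}^{\alpha,\beta}\big|+\frac{|\sigma_{n,1}^{\alpha,\beta}|}{\rho}+\frac{2}{\rho(\rho-1)}\sqrt{\frac{\gamma_0^{\alpha,\beta}}{\gamma_n^{\alpha,\beta}}}\;\bigg], $$ where $$ \sigma_{n,0}^{\alpha,\beta}=\frac{\sqrt \pi}{2}\,\frac{(2n+1)!\,\Gamma(n+\alpha+\beta+1)}{\Gamma(n+3/2)\,\Gamma(2n+\alpha+\beta+1)},\qquad \sigma_{n,1}^{\alpha,\beta}=\frac{(\beta-\alpha)(2n+2)}{2n+\alpha+\beta+2}\,\sigma_{n,0}^{\alpha,\beta}. $$ In particular, if $\alpha=\beta$, then $$ \big|\hat u_n^{\alpha,\alpha}\big|\le\frac{M}{\rho^{n}}\bigg[\big|\sigma_{n,0}^{\alpha,\alpha}\big|+\frac{2}{\rho^2-1}\sqrt{\frac{\gamma_0^{\alpha,\alpha}}{\gamma_n^{\alpha,\alpha}}}\;\bigg]. $$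
   Context: For $\rho>1$, the Bernstein ellipse is $\mathcal E_\rho=\{z\in\mathbb C: z=\tfrac12(w+w^{-1}),\ w=\rho e^{\mathrm i\theta},\ \theta\in[0,2\pi]\}$ (an ellipse with foci $\pm1$), and $\mathcal A_\rho$ is the set of functions analytic on and within $\mathcal E_\rho$. For $\alpha,\beta>-1$, $\omega^{\alpha,\beta}(x)=(1-x)^\alpha(1+x)^\beta$ on $(-1,1)$, and $J_n^{\alpha,\beta}$ is the Jacobi polynomial of degree $n$ in Szegö's normalization, i.e. $\omega^{\alpha,\beta}(x)J_n^{\alpha,\beta}(x)=\frac{(-1)^n}{2^n n!}\frac{d^n}{dx^n}\big[(1-x)^{\alpha+n}(1+x)^{\beta+n}\big]$, so that $\int_{-1}^1J_n^{\alpha,\beta}J_m^{\alpha,\beta}\omega^{\alpha,\beta}\,dx=\gamma_n^{\alpha,\beta}\delta_{m,n}$ with $$\gamma_n^{\alpha,\beta}=\frac{2^{\alpha+\beta+1}\Gamma(n+\alpha+1)\Gamma(n+\beta+1)}{(2n+\alpha+\beta+1)\,n!\,\Gamma(n+\alpha+\beta+1)}.$$ The Jacobi expansion coefficients of $u$ are $\hat u_n^{\alpha,\beta}=\frac{1}{\gamma_n^{\alpha,\beta}}\int_{-1}^1u(x)J_n^{\alpha,\beta}(x)\omega^{\alpha,\beta}(x)\,dx$. When $n=0$ and $\alpha+\beta=-1$, the expressions are read by continuity: $(\alpha+\beta+1)\Gamma(\alpha+\beta+1)=\Gamma(\alpha+\beta+2)$ and $\Gamma(\alpha+\beta+1)/\Gamma(\alpha+\beta+1)=1$.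 *)

theory Defs
  imports "HOL-Complex_Analysis.Complex_Analysis"
begin

definition bernstein_ellipse :: "real \<Rightarrow> complex set" where
  "bernstein_ellipse \<rho> =
     {z. \<exists>\<theta>\<in>{0..2 * pi}. \<exists>w. w = of_real \<rho> * exp (\<i> * of_real \<theta>) \<and> z = (w + inverse w) / 2}"

text \<open>Analytic on and within the ellipse: \<open>inside E\<close> is the union of the bounded components of the
  complement of \<open>E\<close>, and \<open>analytic_on\<close> requires holomorphy in an open neighbourhood of the closed
  region.\<close>

definition bernstein_analytic :: "real \<Rightarrow> (complex \<Rightarrow> complex) set" where
  "bernstein_analytic \<rho> =
     {u. u analytic_on (bernstein_ellipse \<rho> \<union> inside (bernstein_ellipse \<rho>))}"

definition jacobi_weight :: "real \<Rightarrow> real \<Rightarrow> real \<Rightarrow> real" where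
  "jacobi_weight \<alpha> \<beta> x = (1 - x) powr \<alpha> * (1 + x) powr \<beta>"

text \<open>The polynomial determined by the Rodrigues formula; existence and uniqueness are proved in
  \<open>ex1_rodrigues\<close> below.\<close>

definition rodrigues :: "real \<Rightarrow> real \<Rightarrow> nat \<Rightarrow> real poly \<Rightarrow> bool" where
  "rodrigues \<alpha> \<beta> n p \<longleftrightarrow>
     (\<forall>x\<in>{-1<..<1}. jacobi_weight \<alpha> \<beta> x * poly p x =
        (- 1) ^ n / (2 ^ n * fact n) *
        (deriv ^^ n) (\<lambda>t. (1 - t) powr (\<alpha> + real n) * (1 + t) powr (\<beta> + real n)) x)"

definition jacobi_poly :: "real \<Rightarrow> real \<Rightarrow> nat \<Rightarrow> real poly" where
  "jacobi_poly \<alpha> \<beta> n = (THE p. rodrigues \<alpha> \<beta> n p)"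

text \<open>In Isabelle \<open>Gamma 0 = 0\<close>. For \<open>\<alpha>, \<beta> > -1\<close> the argument \<open>n + \<alpha> + \<beta> + 1\<close> hits a pole
  of the Gamma function only when \<open>n = 0\<close> and \<open>\<alpha> + \<beta> = -1\<close>; in that case the formulas below
  take their limit values, \<open>(\<alpha> + \<beta> + 1) * Gamma (\<alpha> + \<beta> + 1)\<close> becoming \<open>Gamma (\<alpha> + \<beta> + 2)\<close>
  and the quotient of equal Gamma values in \<open>jacobi_sigma0\<close> becoming 1.\<close>

definition jacobi_gamma :: "real \<Rightarrow> real \<Rightarrow> nat \<Rightarrow> real" where
  "jacobi_gamma \<alpha> \<beta> n =
     2 powr (\<alpha> + \<beta> + 1) * Gamma (real n + \<alpha> + 1) * Gamma (real n + \<beta> + 1) /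
     (fact n *
       (if n = 0 \<and> \<alpha> + \<beta> = -1 then Gamma (\<alpha> + \<beta> + 2)
        else (2 * real n + \<alpha> + \<beta> + 1) * Gamma (real n + \<alpha> + \<beta> + 1)))"

definition jacobi_coeff :: "real \<Rightarrow> real \<Rightarrow> (complex \<Rightarrow> complex) \<Rightarrow> nat \<Rightarrow> complex" where
  "jacobi_coeff \<alpha> \<beta> u n =
     1 / of_real (jacobi_gamma \<alpha> \<beta> n) *
     (LINT x:{-1<..<1}|lborel.
        u (of_real x) * of_real (poly (jacobi_poly \<alpha> \<beta> n) x) * of_real (jacobi_weight \<alpha> \<beta> x))"

definition jacobi_sigma0 :: "real \<Rightarrow> real \<Rightarrow> nat \<Rightarrow> real" where
  "jacobi_sigma0 \<alpha> \<beta> n =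
     sqrt pi / 2 * (fact (2 * n + 1) / Gamma (real n + 3 / 2)) *
     (if n = 0 \<and> \<alpha> + \<beta> = -1 then 1
      else Gamma (real n + \<alpha> + \<beta> + 1) / Gamma (2 * real n + \<alpha> + \<beta> + 1))"

definition jacobi_sigma1 :: "real \<Rightarrow> real \<Rightarrow> nat \<Rightarrow> real" where
  "jacobi_sigma1 \<alpha> \<beta> n =
     (\<beta> - \<alpha>) * (2 * real n + 2) / (2 * real n + \<alpha> + \<beta> + 2) * jacobi_sigma0 \<alpha> \<beta> n"

lemma higher_deriv_weight:
  fixes A B :: real
  shows "\<exists>p. \<forall>x\<in>{-1<..<1}. (deriv ^^ k) (\<lambda>t. (1 - t) powr A * (1 + t) powr B) x =
     (1 - x) powr (A - real k) * (1 + x) powr (B - real k) * poly p x"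
proof (induction k)
  case 0
  have "\<forall>x\<in>{-1<..<1}. (deriv ^^ 0) (\<lambda>t. (1 - t) powr A * (1 + t) powr B) x =
     (1 - x) powr (A - real 0) * (1 + x) powr (B - real 0) * poly 1 x"
    by simp
  then show ?case by blast
next
  case (Suc k)
  let ?f = "\<lambda>t. (1 - t) powr A * (1 + t) powr B"
  define a where "a = A - real k"
  define b where "b = B - real k"
  obtain p where p: "\<And>x. x \<in> {-1<..<1} \<Longrightarrow>
      (deriv ^^ k) ?f x = (1 - x) powr a * (1 + x) powr b * poly p x"
    using Suc unfolding a_def b_def by blast
  define q where "q = smult (- a) ([:1, 1:] * p) + smult b ([:1, -1:] * p)
      + [:1, -1:] * ([:1, 1:] * pderiv p)"
  have "(deriv ^^ Suc k) ?f x = (1 - x) powr (A - real (Suc k)) * (1 + x) powr (B - real (Suc k)) * poly q x"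
    if x: "x \<in> {-1<..<1}" for x
  proof -
    have pos: "1 - x > 0" "1 + x > 0" using x by auto
    have shift: "(1 - x) powr a = (1 - x) powr (a - 1) * (1 - x)"
      "(1 + x) powr b = (1 + x) powr (b - 1) * (1 + x)"
      using pos by (simp_all add: powr_diff)
    have "((\<lambda>x. (1 - x) powr a * (1 + x) powr b * poly p x) has_field_derivative
        (- (a * (1 - x) powr (a - 1)) * (1 + x) powr b * poly p x
         + (1 - x) powr a * (b * (1 + x) powr (b - 1)) * poly p x
         + (1 - x) powr a * (1 + x) powr b * poly (pderiv p) x)) (at x)"
    proof -
      have 1: "((\<lambda>x. (1 - x) powr a) has_field_derivative - (a * (1 - x) powr (a - 1))) (at x)"
        using pos by (auto intro!: derivative_eq_intros)
      have 2: "((\<lambda>x. (1 + x) powr b) has_field_derivative b * (1 + x) powr (b - 1)) (at x)"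
        using pos by (auto intro!: derivative_eq_intros)
      show ?thesis
        by (rule DERIV_cong[OF DERIV_mult[OF DERIV_mult[OF 1 2] poly_DERIV]])
          (simp add: algebra_simps)
    qed
    also have "(- (a * (1 - x) powr (a - 1)) * (1 + x) powr b * poly p x
         + (1 - x) powr a * (b * (1 + x) powr (b - 1)) * poly p x
         + (1 - x) powr a * (1 + x) powr b * poly (pderiv p) x)
       = (1 - x) powr (a - 1) * (1 + x) powr (b - 1) * poly q x"
    proof -
      define r s where "r = (1 - x) powr (a - 1)" and "s = (1 + x) powr (b - 1)"
      show ?thesis
        unfolding shift q_def r_def[symmetric] s_def[symmetric]
        by (simp add: algebra_simps)
    qed
    finally have "((deriv ^^ k) ?f has_field_derivative
        (1 - x) powr (a - 1) * (1 + x) powr (b - 1) * poly q x) (at x)"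
      by (rule has_field_derivative_transform_within_open[where S = "{-1<..<1}"])
        (use x p in auto)
    then have "deriv ((deriv ^^ k) ?f) x = (1 - x) powr (a - 1) * (1 + x) powr (b - 1) * poly q x"
      by (rule DERIV_imp_deriv)
    moreover have "a - 1 = A - real (Suc k)" "b - 1 = B - real (Suc k)"
      by (simp_all add: a_def b_def)
    ultimately show ?thesis by simp
  qed
  then show ?case by blast
qed

lemma ex1_rodrigues: "\<exists>!p. rodrigues \<alpha> \<beta> n p"
proof -
  have w: "jacobi_weight \<alpha> \<beta> x \<noteq> 0" if "x \<in> {-1<..<1}" for x
    using that by (auto simp: jacobi_weight_def)
  obtain p where p: "\<forall>x\<in>{-1<..<1}.
      (deriv ^^ n) (\<lambda>t. (1 - t) powr (\<alpha> + real n) * (1 + t) powr (\<beta> + real n)) x =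
      (1 - x) powr (\<alpha> + real n - real n) * (1 + x) powr (\<beta> + real n - real n) * poly p x"
    using higher_deriv_weight by blast
  have ex: "rodrigues \<alpha> \<beta> n (smult ((- 1) ^ n / (2 ^ n * fact n)) p)"
    unfolding rodrigues_def using p by (simp add: jacobi_weight_def)
  have un: "p = q" if pq: "rodrigues \<alpha> \<beta> n p" "rodrigues \<alpha> \<beta> n q" for p q
  proof -
    have "jacobi_weight \<alpha> \<beta> x * poly p x = jacobi_weight \<alpha> \<beta> x * poly q x"
      if x: "x \<in> {-1<..<1}" for x
      by (rule trans[OF pq(1)[unfolded rodrigues_def, THEN bspec, OF x]
            pq(2)[unfolded rodrigues_def, THEN bspec, OF x, symmetric]])
    then have eq: "poly p x = poly q x" if "x \<in> {-1<..<1}" for x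
      using that w mult_left_cancel by blast
    have "{-1<..<1::real} \<subseteq> {x. poly (p - q) x = 0}" using eq by (simp add: subset_iff)
    moreover have "infinite {-1<..<1::real}" by (simp add: infinite_Ioo)
    ultimately have "infinite {x. poly (p - q) x = 0}" using finite_subset by blast
    then show ?thesis using poly_roots_finite[of "p - q"] by auto
  qed
  show ?thesis using ex by (rule ex1I) (rule un[OF _ ex])
qed

lemma jacobi_poly_rodrigues: "rodrigues \<alpha> \<beta> n (jacobi_poly \<alpha> \<beta> n)"
  unfolding jacobi_poly_def by (rule theI'[OF ex1_rodrigues])

end

theory Submission
  imports Defs
begin

text \<open>With \<open>z = (w + 1/w)/2\<close> and \<open>x = cos t\<close>, the Cauchy kernel \<open>z'(w) / (z(w) - x)\<close> equals
  \<open>1/(w - e\<^sup>i\<^sup>t) + 1/(w - e\<^sup>-\<^sup>i\<^sup>t) - 1/w = \<Sum> c\<^sub>k(x) w\<^sup>-\<^sup>k\<^sup>-\<^sup>1\<close>, where \<open>c\<^sub>0 = 1\<close> and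
  \<open>c\<^sub>k = 2 T\<^sub>k\<close>. Hence \<open>u = \<Sum> a\<^sub>k c\<^sub>k\<close> on \<open>[-1, 1]\<close> with \<open>\<bar>a\<^sub>k\<bar> \<le> M / \<rho>\<^sup>k\<close>, and the Jacobi
  coefficient of \<open>u\<close> is \<open>\<Sum> a\<^sub>k d\<^sub>k\<close>, where \<open>d\<^sub>k\<close> is the \<open>n\<close>-th Jacobi coefficient of \<open>c\<^sub>k\<close>. By the
  Rodrigues formula and \<open>n\<close> integrations by parts, \<open>d\<^sub>k\<close> is a multiple of the integral of the
  \<open>n\<close>-th derivative of \<open>c\<^sub>k\<close> against the weight with both exponents raised by \<open>n\<close>: it vanishes for
  \<open>k < n\<close>, is explicit for \<open>k = n\<close> and \<open>k = n + 1\<close>, and vanishes for odd \<open>k - n\<close> if \<open>\<alpha> = \<beta>\<close>. The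
  other \<open>d\<^sub>k\<close> are bounded by Cauchy-Schwarz, since \<open>\<bar>c\<^sub>k\<bar> \<le> 2\<close>.\<close>

subsection \<open>Integrals against the Jacobi weight\<close>

lemma jacobi_weight_pos: "x \<in> {-1<..<1} \<Longrightarrow> jacobi_weight a b x > 0"
  by (auto simp: jacobi_weight_def)

lemma jacobi_weight_nonneg: "jacobi_weight a b x \<ge> 0"
  by (simp add: jacobi_weight_def)

lemma jacobi_weight_measurable [measurable]: "jacobi_weight a b \<in> borel_measurable borel"
  unfolding jacobi_weight_def by measurable

lemma jacobi_weight_add_one:
  assumes "x \<in> {-1<..<1}"
  shows "jacobi_weight a b x = jacobi_weight (a - 1) (b - 1) x * ((1 - x) * (1 + x))"
  using assms by (simp add: jacobi_weight_def powr_diff)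

text \<open>Substituting \<open>t = (1 + x)/2\<close> turns the Beta integral over
  \<open>(0,1)\<close> into this one. The Beta integral starts as a gauge integral; nonnegativity of
  the integrand carries it over to the Lebesgue integral.\<close>

lemma has_bochner_integral_jacobi_weight:
  assumes "a > -1" "b > -1"
  shows "has_bochner_integral lborel (\<lambda>x. indicator {-1<..<1} x * jacobi_weight a b x)
           (2 powr (a + b + 1) * Beta (a + 1) (b + 1))"
proof -
  let ?f = "\<lambda>t::real. indicator {0<..<1} t * (t powr b * (1 - t) powr a)"
  have "((\<lambda>t. t powr b * (1 - t) powr a) has_integral Beta (b + 1) (a + 1)) {0<..<1}"
    using has_integral_Beta_real[of "b + 1" "a + 1"] assms by (simp add: has_integral_Icc_iff_Ioo)
  then have "(?f has_integral Beta (b + 1) (a + 1)) UNIV"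
    by (subst (asm) has_integral_restrict_UNIV[symmetric], elim has_integral_eq[rotated])
       (auto simp: indicator_def)
  then have nn: "(\<integral>\<^sup>+t. ennreal (?f t) \<partial>lborel) = ennreal (Beta (b + 1) (a + 1))"
    by (intro nn_integral_has_integral_lborel) auto
  have "Beta (b + 1) (a + 1) > 0"
    using assms by (simp add: Beta_def)
  then have "has_bochner_integral lborel ?f (Beta (b + 1) (a + 1))"
    using nn by (intro has_bochner_integral_nn_integral) auto
  then have "has_bochner_integral lborel (\<lambda>x. ?f (1/2 + 1/2 * x)) (2 * Beta (b + 1) (a + 1))"
    by (subst (asm) lborel_has_bochner_integral_real_affine_iff[of "1/2" _ _ "1/2"]) auto
  then have "has_bochner_integral lborel (\<lambda>x. 2 powr (a + b) * ?f (1/2 + 1/2 * x))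
      (2 powr (a + b) * (2 * Beta (b + 1) (a + 1)))"
    by (intro has_bochner_integral_mult_right) auto
  moreover have "2 powr (a + b) * ?f (1/2 + 1/2 * x) = indicator {-1<..<1} x * jacobi_weight a b x" for x
  proof (cases "x \<in> {-1<..<1}")
    case True
    have "2 powr (a + b) * ((1/2 + 1/2 * x) powr b * (1 - (1/2 + 1/2 * x)) powr a)
        = (2 * (1 - (1/2 + 1/2 * x))) powr a * (2 * (1/2 + 1/2 * x)) powr b"
      by (simp only: powr_mult powr_add mult_ac)
    also have "2 * (1 - (1/2 + 1/2 * x)) = 1 - x"
      by simp
    also have "2 * (1/2 + 1/2 * x) = 1 + x"
      by simp
    finally show ?thesis
      using True by (simp add: jacobi_weight_def)
  qed (auto simp: indicator_def)
  moreover have "2 powr (a + b) * (2 * Beta (b + 1) (a + 1)) = 2 powr (a + b + 1) * Beta (a + 1) (b + 1)"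
    by (simp add: powr_add Beta_commute)
  ultimately show ?thesis
    by simp
qed

lemma set_integrable_jacobi_weight_mult:
  fixes f :: "real \<Rightarrow> 'a::{banach, second_countable_topology, real_normed_algebra_1}"
  assumes "a > -1" "b > -1" "f \<in> borel_measurable borel"
    and "\<And>x. x \<in> {-1<..<1} \<Longrightarrow> norm (f x) \<le> C"
  shows "set_integrable lborel {-1<..<1} (\<lambda>x. f x * of_real (jacobi_weight a b x))"
  unfolding set_integrable_def
proof (rule Bochner_Integration.integrable_bound)
  show "integrable lborel (\<lambda>x. C * (indicator {-1<..<1} x * jacobi_weight a b x))"
    using has_bochner_integral_jacobi_weight[OF assms(1,2)]
    by (intro integrable_mult_right) (auto simp: has_bochner_integral_iff)
  show "(\<lambda>x. indicator {-1<..<1} x *\<^sub>R (f x * of_real (jacobi_weight a b x))) \<in> borel_measurable lborel"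
    using assms(3) by measurable
  show "AE x in lborel. norm (indicator {-1<..<1} x *\<^sub>R (f x * of_real (jacobi_weight a b x)))
      \<le> norm (C * (indicator {-1<..<1} x * jacobi_weight a b x))"
  proof (rule AE_I2)
    fix x :: real
    show "norm (indicator {-1<..<1} x *\<^sub>R (f x * of_real (jacobi_weight a b x)))
      \<le> norm (C * (indicator {-1<..<1} x * jacobi_weight a b x))"
    proof (cases "x \<in> {-1<..<1}")
      case True
      have "norm (f x * of_real (jacobi_weight a b x)) \<le> norm (f x) * norm (of_real (jacobi_weight a b x) :: 'a)"
        by (rule norm_mult_ineq)
      also have "\<dots> \<le> C * jacobi_weight a b x"
        using assms(4)[OF True] jacobi_weight_pos[OF True, of a b] by (simp add: mult_right_mono)
      finally show ?thesis
        using True by (simp add: abs_mult jacobi_weight_nonneg)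
           (use assms(4)[OF True] jacobi_weight_pos[OF True, of a b] norm_ge_zero[of "f x"] in linarith)
    qed simp
  qed
qed

lemma poly_bounded_Ioo:
  fixes p :: "real poly"
  obtains C where "\<And>x. x \<in> {-1<..<1} \<Longrightarrow> \<bar>poly p x\<bar> \<le> C"
proof -
  have "compact ((\<lambda>x. poly p x) ` {-1..1})"
    by (intro compact_continuous_image continuous_intros) auto
  then obtain C where "\<forall>y\<in>(\<lambda>x. poly p x) ` {-1..1}. norm y \<le> C"
    using compact_imp_bounded bounded_iff by blast
  then show ?thesis
    by (intro that[of C]) auto
qed

lemma set_integrable_jacobi_weight_poly:
  assumes "a > -1" "b > -1"
  shows "set_integrable lborel {-1<..<1} (\<lambda>x. poly p x * jacobi_weight a b x)"
proof -
  obtain C where C: "\<And>x. x \<in> {-1<..<1} \<Longrightarrow> \<bar>poly p x\<bar> \<le> C"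
    using poly_bounded_Ioo[of p] by blast
  have "(\<lambda>x. poly p x) \<in> borel_measurable borel"
    by (intro borel_measurable_continuous_onI continuous_intros)
  from set_integrable_jacobi_weight_mult[OF assms this, of C] C show ?thesis
    by simp
qed

definition jacobi_integral :: "real \<Rightarrow> real \<Rightarrow> real poly \<Rightarrow> real" where
  "jacobi_integral a b p = (LINT x:{-1<..<1}|lborel. poly p x * jacobi_weight a b x)"

lemma jacobi_integral_add:
  assumes "a > -1" "b > -1"
  shows "jacobi_integral a b (p + q) = jacobi_integral a b p + jacobi_integral a b q"
  using set_integrable_jacobi_weight_poly[OF assms]
  by (simp add: jacobi_integral_def ring_distribs set_integral_add)

lemma jacobi_integral_smult: "jacobi_integral a b (smult c p) = c * jacobi_integral a b p"
  by (simp add: jacobi_integral_def mult.assoc)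

lemma jacobi_integral_0 [simp]: "jacobi_integral a b 0 = 0"
  by (simp add: jacobi_integral_def)

lemma jacobi_integral_const:
  assumes "a > -1" "b > -1"
  shows "jacobi_integral a b [:c:] = c * (2 powr (a + b + 1) * Beta (a + 1) (b + 1))"
  using has_bochner_integral_jacobi_weight[OF assms]
  by (simp add: jacobi_integral_def set_lebesgue_integral_def has_bochner_integral_iff)
    
text \<open>Reflection at 0 fixes the weight when both exponents agree and negates the polynomial,
  so the integral equals its own negative.\<close>

lemma jacobi_integral_odd:
  assumes "pcompose p [:0, -1:] = - p"
  shows "jacobi_integral a a p = 0"
proof -
  have p: "poly p (-x) = - poly p x" for x
    using arg_cong[OF assms, of "\<lambda>p. poly p x"] by (simp add: poly_pcompose)
  have "jacobi_integral a a p = (LBINT x. indicator {-1<..<1} (- x) *\<^sub>R (poly p (- x) * jacobi_weight a a (- x)))"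
    unfolding jacobi_integral_def set_lebesgue_integral_def
    by (subst lborel_integral_real_affine[of "-1" _ 0]) auto
  also have "\<dots> = (LBINT x. - (indicator {-1<..<1} x *\<^sub>R (poly p x * jacobi_weight a a x)))"
    by (intro Bochner_Integration.integral_cong)
       (auto simp: p jacobi_weight_def indicator_def mult.commute)
  also have "\<dots> = - jacobi_integral a a p"
    by (simp add: jacobi_integral_def set_lebesgue_integral_def)
  finally show ?thesis by simp
qed

section \<open>Differentiation and integration by parts against the weight\<close>

definition jacobi_diff :: "real \<Rightarrow> real \<Rightarrow> real poly \<Rightarrow> real poly" where
  "jacobi_diff a b p = [:1, 0, -1:] * pderiv p + [:b - a, - (a + b):] * p"

text \<open>\<open>jacobi_diff\<close> is the polynomial left when the weight with both exponents
  lowered by one is factored out of the derivative; the lowering puts the factor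
  \<open>1 - x^2\<close> in front of \<open>pderiv p\<close>.\<close>

lemma DERIV_jacobi_weight_poly:
  assumes "x \<in> {-1<..<1}"
  shows "((\<lambda>x. poly p x * jacobi_weight a b x) has_field_derivative
           poly (jacobi_diff a b p) x * jacobi_weight (a - 1) (b - 1) x) (at x)"
proof -
  have pos: "1 - x > 0" "1 + x > 0" using assms by auto
  define r s where "r = (1 - x) powr (a - 1)" and "s = (1 + x) powr (b - 1)"
  have rs: "(1 - x) powr a = r * (1 - x)" "(1 + x) powr b = s * (1 + x)"
    using pos by (simp_all add: powr_diff r_def s_def)
  have 1: "((\<lambda>x. (1 - x) powr a) has_field_derivative - (a * r)) (at x)"
    using pos by (auto intro!: derivative_eq_intros simp: r_def)
  have 2: "((\<lambda>x. (1 + x) powr b) has_field_derivative b * s) (at x)"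
    using pos by (auto intro!: derivative_eq_intros simp: s_def)
  show ?thesis
    unfolding jacobi_weight_def
    by (rule DERIV_cong[OF DERIV_mult[OF poly_DERIV DERIV_mult[OF 1 2]]])
       (simp add: rs r_def[symmetric] s_def[symmetric] jacobi_diff_def algebra_simps)
qed

lemma isCont_jacobi_weight: "x \<in> {-1<..<1} \<Longrightarrow> isCont (jacobi_weight a b) x"
  unfolding jacobi_weight_def by (intro continuous_intros) auto

text \<open>The integrand is the derivative of \<open>p\<close> times a weight with positive
  exponents, which vanishes at both endpoints. The lowered weight may blow up there, so the
  fundamental theorem is applied on the open interval with one-sided limits.\<close>

lemma jacobi_integral_diff:
  assumes "a > 0" "b > 0"
  shows "jacobi_integral (a - 1) (b - 1) (jacobi_diff a b p) = 0"
proof -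
  let ?F = "\<lambda>x. poly p x * jacobi_weight a b x"
  let ?f = "\<lambda>x. poly (jacobi_diff a b p) x * jacobi_weight (a - 1) (b - 1) x"
  have cont: "continuous_on {-1..1} ?F"
    unfolding jacobi_weight_def using assms by (intro continuous_intros continuous_on_powr') auto
  have ends: "?F (-1) = 0" "?F 1 = 0"
    using assms by (auto simp: jacobi_weight_def)
  have l: "(?F \<longlongrightarrow> 0) (at_right (-1))"
    using cont ends(1) continuous_on_Icc_at_rightD by fastforce
  have r: "(?F \<longlongrightarrow> 0) (at_left 1)"
    using cont ends(2) continuous_on_Icc_at_leftD by fastforce
  have "(LBINT x=ereal (-1)..ereal 1. ?f x) = 0 - 0"
  proof (rule interval_integral_FTC_integrable)
    show "(?F has_vector_derivative ?f x) (at x)" if "ereal (-1) < ereal x" "ereal x < ereal 1" for x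
      using DERIV_jacobi_weight_poly[of x p a b] that
      by (simp add: has_real_derivative_iff_has_vector_derivative)
    show "isCont ?f x" if "ereal (-1) < ereal x" "ereal x < ereal 1" for x
      using that by (intro continuous_intros isCont_jacobi_weight) auto
    show "set_integrable lborel (einterval (ereal (-1)) (ereal 1)) ?f"
      using set_integrable_jacobi_weight_poly[of "a - 1" "b - 1"] assms by simp
    show "((?F \<circ> real_of_ereal) \<longlongrightarrow> 0) (at_right (ereal (-1)))"
      "((?F \<circ> real_of_ereal) \<longlongrightarrow> 0) (at_left (ereal 1))"
      using l r by (simp_all only: ereal_tendsto_simps)
  qed simp
  then show ?thesis
    by (simp add: jacobi_integral_def interval_integral_Ioo)
qed

text \<open>The product rule gives \<open>jacobi_diff\<close> of \<open>f * q\<close> the extra term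
  \<open>(1 - x^2) f' q\<close>, and the factor \<open>1 - x^2\<close> raises both exponents of the
  weight back by one.\<close>

lemma jacobi_integral_by_parts:
  assumes "a > 0" "b > 0"
  shows "jacobi_integral (a - 1) (b - 1) (f * jacobi_diff a b q) = - jacobi_integral a b (pderiv f * q)"
proof -
  have "jacobi_diff a b (f * q) = f * jacobi_diff a b q + [:1, 0, -1:] * (pderiv f * q)"
    by (simp add: jacobi_diff_def pderiv_mult algebra_simps)
  then have "jacobi_integral (a - 1) (b - 1) (f * jacobi_diff a b q)
      + jacobi_integral (a - 1) (b - 1) ([:1, 0, -1:] * (pderiv f * q)) = 0"
    using jacobi_integral_diff[OF assms, of "f * q"] assms
    by (simp only: jacobi_integral_add[symmetric])
  moreover have "jacobi_integral (a - 1) (b - 1) ([:1, 0, -1:] * (pderiv f * q)) = jacobi_integral a b (pderiv f * q)"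
    unfolding jacobi_integral_def
    by (intro set_lebesgue_integral_cong) (auto simp: jacobi_weight_add_one[of _ a b] algebra_simps)
  ultimately show ?thesis by simp
qed

text \<open>With exponents \<open>a + 1\<close> and \<open>b + 1\<close>, \<open>jacobi_diff\<close>
  maps 1 to \<open>(b - a) - (a + b + 2) x\<close>. Its integral is 0, which ties the first moment
  to the total mass.\<close>

lemma jacobi_integral_X:
  assumes "a > -1" "b > -1"
  shows "jacobi_integral a b [:0, 1:] = (b - a) / (a + b + 2) * jacobi_integral a b 1"
proof -
  have "jacobi_integral a b (jacobi_diff (a + 1) (b + 1) 1) = 0"
    using jacobi_integral_diff[of "a + 1" "b + 1" 1] assms by simp
  also have "jacobi_diff (a + 1) (b + 1) 1 = smult (b - a) 1 + smult (- (a + b + 2)) [:0, 1:]"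
    by (simp add: jacobi_diff_def one_pCons)
  finally have "(b - a) * jacobi_integral a b 1 + (- (a + b + 2)) * jacobi_integral a b [:0, 1:] = 0"
    by (simp only: jacobi_integral_add[OF assms] jacobi_integral_smult)
  then show ?thesis
    using assms by (simp add: field_simps)
qed

section \<open>The Rodrigues formula on the level of polynomials\<close>

fun rodrigues_poly :: "real \<Rightarrow> real \<Rightarrow> nat \<Rightarrow> real poly" where
  "rodrigues_poly A B 0 = 1"
| "rodrigues_poly A B (Suc k) = jacobi_diff (A - real k) (B - real k) (rodrigues_poly A B k)"

text \<open>Each differentiation lowers both exponents by one and applies \<open>jacobi_diff\<close>
  with the current exponents; \<open>rodrigues_poly\<close> collects the polynomial factor.\<close>

lemma higher_deriv_jacobi_weight:
  assumes "x \<in> {-1<..<1}"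
  shows "(deriv ^^ k) (jacobi_weight A B) x
    = poly (rodrigues_poly A B k) x * jacobi_weight (A - real k) (B - real k) x"
  using assms
proof (induction k arbitrary: x)
  case (Suc k)
  have "((deriv ^^ k) (jacobi_weight A B) has_field_derivative
     poly (rodrigues_poly A B (Suc k)) x * jacobi_weight (A - real (Suc k)) (B - real (Suc k)) x) (at x)"
  proof (rule has_field_derivative_transform_within_open[where S = "{-1<..<1}"])
    show "((\<lambda>x. poly (rodrigues_poly A B k) x * jacobi_weight (A - real k) (B - real k) x)
        has_field_derivative
     poly (rodrigues_poly A B (Suc k)) x * jacobi_weight (A - real (Suc k)) (B - real (Suc k)) x) (at x)"
      using DERIV_jacobi_weight_poly[OF Suc.prems, of "rodrigues_poly A B k" "A - real k" "B - real k"]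
      by (simp add: algebra_simps)
  qed (use Suc in auto)
  then show ?case
    by (simp add: DERIV_imp_deriv)
qed simp

text \<open>Uniqueness in the Rodrigues formula replaces the definite description by an explicit
  recursion.\<close>

lemma jacobi_poly_eq:
  "jacobi_poly \<alpha> \<beta> n =
     smult ((- 1) ^ n / (2 ^ n * fact n)) (rodrigues_poly (\<alpha> + real n) (\<beta> + real n) n)"
proof -
  have *: "(\<lambda>t. (1 - t) powr (\<alpha> + real n) * (1 + t) powr (\<beta> + real n))
      = jacobi_weight (\<alpha> + real n) (\<beta> + real n)"
    by (simp add: jacobi_weight_def fun_eq_iff)
  have "rodrigues \<alpha> \<beta> n
     (smult ((- 1) ^ n / (2 ^ n * fact n)) (rodrigues_poly (\<alpha> + real n) (\<beta> + real n) n))"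
    unfolding rodrigues_def * by (auto simp: higher_deriv_jacobi_weight)
  then show ?thesis
    using ex1_rodrigues jacobi_poly_rodrigues by blast
qed

text \<open>Each integration by parts strips the outermost \<open>jacobi_diff\<close>, moves one
  derivative onto \<open>f\<close>, raises both exponents by one and changes the sign.\<close>

lemma jacobi_integral_rodrigues_poly:
  assumes "A - real k > -1" "B - real k > -1"
  shows "jacobi_integral (A - real k) (B - real k) (f * rodrigues_poly A B k)
    = (- 1) ^ k * jacobi_integral A B ((pderiv ^^ k) f)"
  using assms
proof (induction k arbitrary: f)
  case (Suc k)
  have "jacobi_integral (A - real k - 1) (B - real k - 1) (f * rodrigues_poly A B (Suc k))
    = - jacobi_integral (A - real k) (B - real k) (pderiv f * rodrigues_poly A B k)"
    using Suc.prems by (simp add: jacobi_integral_by_parts)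
  also have "\<dots> = - ((- 1) ^ k * jacobi_integral A B ((pderiv ^^ k) (pderiv f)))"
    using Suc.prems by (subst Suc.IH) auto
  finally show ?case
    by (simp add: funpow_swap1 algebra_simps)
qed simp

lemma jacobi_integral_jacobi_poly:
  assumes "\<alpha> > -1" "\<beta> > -1"
  shows "jacobi_integral \<alpha> \<beta> (f * jacobi_poly \<alpha> \<beta> n)
    = jacobi_integral (\<alpha> + real n) (\<beta> + real n) ((pderiv ^^ n) f) / (2 ^ n * fact n)"
  using jacobi_integral_rodrigues_poly[of "\<alpha> + real n" n "\<beta> + real n" f] assms
  by (simp add: jacobi_poly_eq jacobi_integral_smult)

text \<open>The step from \<open>k\<close> to \<open>k + 1\<close> multiplies the leading
  coefficient by \<open>-(A + B - k)\<close>: the part \<open>-x^2 p'\<close> contributes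
  \<open>-k\<close>, the part \<open>-(a + b) x p\<close> contributes
  \<open>-(A + B - 2 k)\<close>.\<close>

lemma degree_rodrigues_poly: "degree (rodrigues_poly A B k) \<le> k"
  and coeff_rodrigues_poly: "coeff (rodrigues_poly A B k) k = (- 1) ^ k * (\<Prod>i<k. A + B - real i)"
proof (induction k)
  case (Suc k)
  let ?p = "rodrigues_poly A B k"
  have 0: "coeff ?p i = 0" if "i > k" for i
    using Suc.IH(1) that by (simp add: coeff_eq_0)
  have c: "coeff (rodrigues_poly A B (Suc k)) (Suc j) =
     - (A + B - 2 * real k + real j) * coeff ?p j + (B - A) * coeff ?p (Suc j)
       + real (j + 2) * coeff ?p (j + 2)" for j
    by (cases j) (simp_all add: jacobi_diff_def coeff_pCons coeff_pderiv algebra_simps)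
  show "degree (rodrigues_poly A B (Suc k)) \<le> Suc k"
  proof (rule degree_le, intro allI impI)
    fix i assume "Suc k < i"
    then obtain j where "i = Suc j" "j > k" by (cases i) auto
    then show "coeff (rodrigues_poly A B (Suc k)) i = 0" 
      by (simp only: c) (simp add: 0)
  qed
  show "coeff (rodrigues_poly A B (Suc k)) (Suc k) = (- 1) ^ Suc k * (\<Prod>i<Suc k. A + B - real i)"
    by (simp only: c) (simp add: 0 Suc.IH(2) algebra_simps)
qed simp_all

lemma higher_pderiv_degree_le:
  fixes p :: "real poly"
  assumes "degree p \<le> n"
  shows "(pderiv ^^ n) p = [:fact n * coeff p n:]"
proof (rule poly_eqI)
  fix i
  show "coeff ((pderiv ^^ n) p) i = coeff [:fact n * coeff p n:] i"
    using assms by (cases i) (auto simp: coeff_higher_pderiv coeff_eq_0 pochhammer_fact)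
qed

subsection \<open>Normalization constants\<close>

lemma prod_eq_pochhammer: "(\<Prod>i<n. z + real n - real i) = pochhammer (z + 1) n"
proof -
  have "pochhammer (z + 1) n = (\<Prod>i<n. z + 1 + real i)"
    by (simp add: pochhammer_prod lessThan_atLeast0)
  also have "\<dots> = (\<Prod>i<n. z + 1 + real (n - Suc i))"
    by (rule prod.nat_diff_reindex[symmetric])
  also have "\<dots> = (\<Prod>i<n. z + real n - real i)"
    by (intro prod.cong) (auto simp: of_nat_diff)
  finally show ?thesis ..
qed

lemma coeff_jacobi_poly:
  "coeff (jacobi_poly \<alpha> \<beta> n) n = pochhammer (real n + \<alpha> + \<beta> + 1) n / (2 ^ n * fact n)"
  using prod_eq_pochhammer[of "real n + \<alpha> + \<beta>" n]
  by (simp add: jacobi_poly_eq coeff_rodrigues_poly algebra_simps flip: power_add mult_2)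

lemma degree_jacobi_poly: "degree (jacobi_poly \<alpha> \<beta> n) \<le> n"
  using degree_rodrigues_poly by (simp add: jacobi_poly_eq)

lemma pochhammer_jacobi_pos:
  fixes \<alpha> \<beta> :: real
  assumes "\<alpha> > -1" "\<beta> > -1"
  shows "pochhammer (real n + \<alpha> + \<beta> + 1) n > 0"
  using assms by (cases n) (auto intro: pochhammer_pos)

text \<open>Outside the case \<open>n = 0\<close>, \<open>\<alpha> + \<beta> = -1\<close> the
  arguments \<open>n + \<alpha> + \<beta> + 1\<close> and
  \<open>2 n + \<alpha> + \<beta> + 1\<close> avoid the poles of Gamma, so its recurrence
  applies.\<close>

lemma Gamma_eq_pochhammer:
  fixes \<alpha> \<beta> :: real
  assumes "\<alpha> > -1" "\<beta> > -1" "\<not> (n = 0 \<and> \<alpha> + \<beta> = -1)"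
  shows "Gamma (2 * real n + \<alpha> + \<beta> + 1) = pochhammer (real n + \<alpha> + \<beta> + 1) n * Gamma (real n + \<alpha> + \<beta> + 1)"
    and "Gamma (real n + \<alpha> + \<beta> + 1) \<noteq> 0"
    and "Gamma (2 * real n + \<alpha> + \<beta> + 2) = (2 * real n + \<alpha> + \<beta> + 1) * Gamma (2 * real n + \<alpha> + \<beta> + 1)"
proof -
  \<comment> \<open>Stated for every \<open>m\<close> that vanishes exactly when \<open>n\<close>
    does, so that it serves both \<open>m = n\<close> and \<open>m = 2 * n\<close>.\<close>
  have z: "real m + \<alpha> + \<beta> + 1 \<notin> \<int>\<^sub>\<le>\<^sub>0" if "m = 0 \<longleftrightarrow> n = 0" for m
  proof
    assume "real m + \<alpha> + \<beta> + 1 \<in> \<int>\<^sub>\<le>\<^sub>0"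
    then obtain k where k: "real m + \<alpha> + \<beta> + 1 = - real k"
      by (auto elim!: nonpos_Ints_cases')
    show False
    proof (cases "m = 0")
      case True
      then have "k = 0" using k assms by (cases k) auto
      then show False using True that k assms(3) by auto
    next
      case False
      then have "real m \<ge> 1" by simp
      then show False using k assms by linarith
    qed
  qed
  show 2: "Gamma (real n + \<alpha> + \<beta> + 1) \<noteq> 0"
    using z[of n] by (simp add: Gamma_eq_zero_iff)
  show "Gamma (2 * real n + \<alpha> + \<beta> + 1) = pochhammer (real n + \<alpha> + \<beta> + 1) n * Gamma (real n + \<alpha> + \<beta> + 1)"
    using pochhammer_Gamma[OF z[of n]] 2 by (simp add: field_simps)
  have "2 * real n + \<alpha> + \<beta> + 1 \<noteq> 0"
    using z[of "2 * n"] by auto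
  then show "Gamma (2 * real n + \<alpha> + \<beta> + 2) = (2 * real n + \<alpha> + \<beta> + 1) * Gamma (2 * real n + \<alpha> + \<beta> + 1)"
    using Gamma_plus1[of "2 * real n + \<alpha> + \<beta> + 1"] z[of "2 * n"] by (simp add: add.assoc)
qed

text \<open>The constant is expressed through the mass of the raised weight, which later cancels.
  The exceptional case is covered as well, because a Pochhammer symbol of length 0 is 1.\<close>

lemma jacobi_gamma_eq:
  assumes "\<alpha> > -1" "\<beta> > -1"
  shows "jacobi_gamma \<alpha> \<beta> n = pochhammer (real n + \<alpha> + \<beta> + 1) n / (4 ^ n * fact n) *
           jacobi_integral (\<alpha> + real n) (\<beta> + real n) 1"
proof -
  define P where "P = pochhammer (real n + \<alpha> + \<beta> + 1) n"
  have P: "P > 0" unfolding P_def by (rule pochhammer_jacobi_pos[OF assms])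
  have *: "(if n = 0 \<and> \<alpha> + \<beta> = -1 then Gamma (\<alpha> + \<beta> + 2)
        else (2 * real n + \<alpha> + \<beta> + 1) * Gamma (real n + \<alpha> + \<beta> + 1)) = Gamma (2 * real n + \<alpha> + \<beta> + 2) / P"
    (is "?l = _")
  proof (cases "n = 0 \<and> \<alpha> + \<beta> = -1")
    case True
    then show ?thesis by (simp add: P_def)
  next
    case False
    show ?thesis
      using Gamma_eq_pochhammer[OF assms False] False P by (simp add: P_def field_simps)
  qed
  have "2 powr (\<alpha> + real n + (\<beta> + real n) + 1) = 2 powr (\<alpha> + \<beta> + 1) * 2 powr real (2 * n)"
    by (simp add: powr_add[symmetric] algebra_simps)
  also have "2 powr real (2 * n) = (4::real) ^ n"
    by (simp only: powr_realpow) (simp add: power_mult)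
  finally have I: "jacobi_integral (\<alpha> + real n) (\<beta> + real n) 1 =
      2 powr (\<alpha> + \<beta> + 1) * 4 ^ n * Gamma (real n + \<alpha> + 1) * Gamma (real n + \<beta> + 1) /
        Gamma (2 * real n + \<alpha> + \<beta> + 2)"
    using jacobi_integral_const[of "\<alpha> + real n" "\<beta> + real n" 1] assms
    by (simp add: one_pCons Beta_def algebra_simps)
  show ?thesis
    unfolding jacobi_gamma_def * I P_def[symmetric] using P by (simp add: field_simps)
qed

lemma jacobi_integral_1_pos:
  assumes "a > -1" "b > -1"
  shows "jacobi_integral a b 1 > 0"
  using jacobi_integral_const[OF assms, of 1] assms by (simp add: one_pCons Beta_def)

lemma jacobi_gamma_pos:
  assumes "\<alpha> > -1" "\<beta> > -1"
  shows "jacobi_gamma \<alpha> \<beta> n > 0"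
  using assms pochhammer_jacobi_pos[OF assms, of n] jacobi_integral_1_pos[of "\<alpha> + real n" "\<beta> + real n"]
  by (simp add: jacobi_gamma_eq)

lemma jacobi_gamma_0:
  assumes "\<alpha> > -1" "\<beta> > -1"
  shows "jacobi_gamma \<alpha> \<beta> 0 = jacobi_integral \<alpha> \<beta> 1"
  using assms by (simp add: jacobi_gamma_eq)

text \<open>After \<open>n\<close> integrations by parts one factor has become the constant
  \<open>n!\<close> times its leading coefficient, and the mass of the raised weight
  remains.\<close>

lemma jacobi_integral_square_jacobi_poly:
  assumes "\<alpha> > -1" "\<beta> > -1"
  shows "jacobi_integral \<alpha> \<beta> (jacobi_poly \<alpha> \<beta> n * jacobi_poly \<alpha> \<beta> n) = jacobi_gamma \<alpha> \<beta> n"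
proof -
  let ?c = "coeff (jacobi_poly \<alpha> \<beta> n) n"
  have "jacobi_integral \<alpha> \<beta> (jacobi_poly \<alpha> \<beta> n * jacobi_poly \<alpha> \<beta> n)
      = jacobi_integral (\<alpha> + real n) (\<beta> + real n) (smult (fact n * ?c) 1) / (2 ^ n * fact n)"
    by (simp add: jacobi_integral_jacobi_poly[OF assms] higher_pderiv_degree_le degree_jacobi_poly one_pCons)
  also have "\<dots> = jacobi_gamma \<alpha> \<beta> n"
    unfolding jacobi_integral_smult
    by (simp add: coeff_jacobi_poly jacobi_gamma_eq[OF assms] flip: power_mult_distrib)
  finally show ?thesis .
qed

text \<open>A form of the duplication formula that clears \<open>sqrt pi\<close> and the
  half-integer Gamma value from \<open>jacobi_sigma0\<close>: raising \<open>n\<close> by one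
  multiplies both sides by \<open>4 (n + 1)\<close>.\<close>

lemma fact_div_Gamma_half: "sqrt pi / 2 * (fact (2 * n + 1) / Gamma (real n + 3 / 2)) = 4 ^ n * fact n"
proof (induction n)
  case 0
  have "Gamma (3 / 2 :: real) = sqrt pi / 2"
    using Gamma_plus1[of "1 / 2 :: real"] nonpos_Ints_nonpos[of "1 / 2 :: real"]
    by (auto simp: Gamma_one_half_real)
  moreover have "Gamma (3 / 2 :: real) \<noteq> 0"
    unfolding calculation by simp
  ultimately show ?case by simp
next
  case (Suc n)
  have G: "Gamma (real (Suc n) + 3 / 2) = (real n + 3 / 2) * Gamma (real n + 3 / 2)"
    using Gamma_plus1[of "real n + 3 / 2"] nonpos_Ints_nonpos[of "real n + 3 / 2"] by (auto simp: add_ac)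
  have F: "fact (2 * Suc n + 1) = (4 * (real n + 3 / 2) * real (Suc n)) * fact (2 * n + 1)"
    by (simp add: algebra_simps)
  have "sqrt pi / 2 * (fact (2 * Suc n + 1) / Gamma (real (Suc n) + 3 / 2))
      = 4 * real (Suc n) * (sqrt pi / 2 * (fact (2 * n + 1) / Gamma (real n + 3 / 2)))"
    unfolding G F by (simp add: divide_simps) (simp add: algebra_simps)
  then show ?case
    by (simp only: Suc.IH) simp
qed

lemma jacobi_sigma0_eq:
  assumes "\<alpha> > -1" "\<beta> > -1"
  shows "jacobi_sigma0 \<alpha> \<beta> n = 4 ^ n * fact n / pochhammer (real n + \<alpha> + \<beta> + 1) n"
proof (cases "n = 0 \<and> \<alpha> + \<beta> = -1")
  case True
  then show ?thesis using fact_div_Gamma_half[of n] by (simp add: jacobi_sigma0_def)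
next
  case False
  then show ?thesis
    unfolding jacobi_sigma0_def fact_div_Gamma_half
    using Gamma_eq_pochhammer[OF assms False] by simp
qed

lemma jacobi_integral_div_gamma:
  assumes "\<alpha> > -1" "\<beta> > -1"
  shows "jacobi_integral (\<alpha> + real n) (\<beta> + real n) 1 / jacobi_gamma \<alpha> \<beta> n = jacobi_sigma0 \<alpha> \<beta> n"
  using assms pochhammer_jacobi_pos[OF assms, of n] jacobi_integral_1_pos[of "\<alpha> + real n" "\<beta> + real n"]
  by (simp add: jacobi_gamma_eq jacobi_sigma0_eq)

subsection \<open>Jacobi coefficients of Chebyshev polynomials\<close>

fun cheb_poly :: "nat \<Rightarrow> real poly" where
  "cheb_poly 0 = 1"
| "cheb_poly (Suc 0) = [:0, 1:]"
| "cheb_poly (Suc (Suc k)) = smult 2 ([:0, 1:] * cheb_poly (Suc k)) - cheb_poly k"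

text \<open>The Chebyshev expansion of a function with Laurent coefficients \<open>a\<^sub>k\<close> in the variable
  \<open>w\<close> is \<open>a\<^sub>0 + 2 \<Sum> a\<^sub>k T\<^sub>k\<close>; the polynomial multiplying \<open>a\<^sub>k\<close> has leading
  coefficient \<open>2 ^ k\<close> also for \<open>k = 0\<close>.\<close>

definition cheb_term :: "nat \<Rightarrow> real poly" where
  "cheb_term k = (if k = 0 then 1 else smult 2 (cheb_poly k))"

lemma poly_cheb_poly_cos: "poly (cheb_poly k) (cos t) = cos (real k * t)"
proof (induction k rule: cheb_poly.induct)
  case (3 k)
  have "cos (real (Suc (Suc k)) * t) + cos (real k * t) = 2 * cos t * cos (real (Suc k) * t)"
    using cos_times_cos[of t "real (Suc k) * t"] by (simp add: algebra_simps)
  then show ?case using 3 by simp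
qed simp_all

text \<open>\<open>2 cos (k t)\<close> is the sum of the two conjugate powers; for
  \<open>k = 0\<close> this sum counts the constant 1 twice, hence the correction.\<close>

lemma poly_cheb_term_cos:
  "complex_of_real (poly (cheb_term k) (cos t)) = cis t ^ k + cnj (cis t) ^ k - (if k = 0 then 1 else 0)"
  by (simp add: cheb_term_def poly_cheb_poly_cos Complex.DeMoivre cis_cnj complex_eq_iff)

lemma abs_poly_cheb_term_le:
  assumes "x \<in> {-1..1}"
  shows "\<bar>poly (cheb_term k) x\<bar> \<le> 2"
proof -
  have "poly (cheb_poly k) x = cos (real k * arccos x)"
    using assms poly_cheb_poly_cos[of k "arccos x"] by simp
  then show ?thesis by (simp add: cheb_term_def abs_mult)
qed

text \<open>The exponent \<open>j = k - 1\<close> of the leading coefficient makes sense from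
  \<open>k = 1\<close> on. The zero just below the leading coefficient is what makes the case
  \<open>k = n + 1\<close> explicit later.\<close>

lemma coeff_cheb_poly:
  "(\<forall>i>k. coeff (cheb_poly k) i = 0) \<and> (\<forall>j. k = Suc j \<longrightarrow> coeff (cheb_poly k) k = 2 ^ j \<and> coeff (cheb_poly k) j = 0)"
proof (induction k rule: cheb_poly.induct)
  case (3 k)
  have c: "coeff (cheb_poly (Suc (Suc k))) (Suc i) = 2 * coeff (cheb_poly (Suc k)) i - coeff (cheb_poly k) (Suc i)" for i
    by simp
  have "coeff (cheb_poly (Suc (Suc k))) i = 0" if gt: "i > Suc (Suc k)" for i
  proof -
    obtain j where "i = Suc j" "j > Suc k" using gt by (cases i) auto
    then show ?thesis using 3 by (simp only: c)
  qed
  then show ?case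
    using 3 by (simp only: c) auto
qed (auto simp: coeff_pCons split: nat.splits)

lemma degree_cheb_term: "degree (cheb_term k) \<le> k"
  using coeff_cheb_poly[of k] by (intro degree_le) (auto simp: cheb_term_def)

lemma coeff_cheb_term: "coeff (cheb_term k) k = 2 ^ k" "coeff (cheb_term (Suc k)) k = 0"
  using coeff_cheb_poly[of k] coeff_cheb_poly[of "Suc k"] by (cases k; auto simp: cheb_term_def)+

lemma pcompose_cheb_term: "pcompose (cheb_term k) [:0, -1:] = smult ((- 1) ^ k) (cheb_term k)"
proof -
  have "pcompose (cheb_poly k) [:0, -1:] = smult ((- 1) ^ k) (cheb_poly k)"
    by (induction k rule: cheb_poly.induct)
       (simp_all add: pcompose_1 pcompose_diff pcompose_mult pcompose_smult pcompose_pCons smult_diff_right mult.commute)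
  then show ?thesis by (simp add: cheb_term_def pcompose_smult pcompose_1 mult.commute)
qed

lemma higher_pderiv_pcompose_uminus:
  fixes p :: "real poly"
  shows "(pderiv ^^ n) (pcompose p [:0, -1:]) = smult ((- 1) ^ n) (pcompose ((pderiv ^^ n) p) [:0, -1:])"
proof (induction n arbitrary: p)
  case (Suc n)
  have "(pderiv ^^ Suc n) (pcompose p [:0, -1:]) = (pderiv ^^ n) (smult (-1) (pcompose (pderiv p) [:0, -1:]))"
    by (simp add: funpow_swap1 pderiv_pcompose pderiv_pCons)
  also have "\<dots> = smult (-1) (smult ((- 1) ^ n) (pcompose ((pderiv ^^ n) (pderiv p)) [:0, -1:]))"
    by (simp only: higher_pderiv_smult Suc.IH)
  finally show ?case by (simp add: funpow_swap1)
qed simp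

section \<open>Explicit values, uniform bound and parity of the coefficients\<close>

definition cheb_jacobi_coeff :: "real \<Rightarrow> real \<Rightarrow> nat \<Rightarrow> nat \<Rightarrow> real" where
  "cheb_jacobi_coeff \<alpha> \<beta> n k = jacobi_integral \<alpha> \<beta> (cheb_term k * jacobi_poly \<alpha> \<beta> n) / jacobi_gamma \<alpha> \<beta> n"

context
  fixes \<alpha> \<beta> :: real and n :: nat
  assumes ab: "\<alpha> > -1" "\<beta> > -1"
begin

lemma cheb_jacobi_coeff_eq:
  "cheb_jacobi_coeff \<alpha> \<beta> n k =
     jacobi_integral (\<alpha> + real n) (\<beta> + real n) ((pderiv ^^ n) (cheb_term k)) / (2 ^ n * fact n * jacobi_gamma \<alpha> \<beta> n)"
  by (simp add: cheb_jacobi_coeff_def jacobi_integral_jacobi_poly[OF ab])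

lemma cheb_jacobi_coeff_less: "k < n \<Longrightarrow> cheb_jacobi_coeff \<alpha> \<beta> n k = 0"
  using degree_cheb_term[of k]
  by (simp add: cheb_jacobi_coeff_eq higher_pderiv_degree_le coeff_eq_0)

text \<open>Only the leading coefficient \<open>2 ^ n\<close> survives \<open>n\<close>
  differentiations; the constants cancel and leave the mass of the raised weight over
  \<open>jacobi_gamma\<close>.\<close>

lemma cheb_jacobi_coeff_n: "cheb_jacobi_coeff \<alpha> \<beta> n n = jacobi_sigma0 \<alpha> \<beta> n"
proof -
  have "(pderiv ^^ n) (cheb_term n) = smult (fact n * 2 ^ n) 1"
    by (simp add: higher_pderiv_degree_le degree_cheb_term coeff_cheb_term one_pCons)
  then show ?thesis
    unfolding cheb_jacobi_coeff_eq by (simp only: jacobi_integral_smult) (simp flip: jacobi_integral_div_gamma[OF ab])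
qed

text \<open>\<open>cheb_term (Suc n)\<close> has no term of degree \<open>n\<close>, so its
  \<open>n\<close>-th derivative is a pure multiple of \<open>x\<close> and the first moment of the
  raised weight gives the value.\<close>

lemma cheb_jacobi_coeff_Suc: "cheb_jacobi_coeff \<alpha> \<beta> n (Suc n) = jacobi_sigma1 \<alpha> \<beta> n"
proof -
  have "(pderiv ^^ n) (cheb_term (Suc n)) = smult (fact (Suc n) * 2 ^ Suc n) [:0, 1:]"
  proof (rule poly_eqI)
    fix i
    have "coeff (cheb_term (Suc n)) j = 0" if "j > Suc n" for j
      using degree_cheb_term[of "Suc n"] that by (simp add: coeff_eq_0)
    moreover have "pochhammer (2::real) n = fact (Suc n)"
      by (simp add: pochhammer_fact pochhammer_rec)
    ultimately show "coeff ((pderiv ^^ n) (cheb_term (Suc n))) i = coeff (smult (fact (Suc n) * 2 ^ Suc n) [:0, 1:]) i"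
      by (auto simp: coeff_higher_pderiv coeff_pCons coeff_cheb_term split: nat.splits)
  qed
  then have "cheb_jacobi_coeff \<alpha> \<beta> n (Suc n) = (2 * real n + 2) *
      (jacobi_integral (\<alpha> + real n) (\<beta> + real n) [:0, 1:] / jacobi_gamma \<alpha> \<beta> n)"
    unfolding cheb_jacobi_coeff_eq using jacobi_gamma_pos[OF ab, of n]
    by (simp only: jacobi_integral_smult) (simp add: field_simps)
  also have "jacobi_integral (\<alpha> + real n) (\<beta> + real n) [:0, 1:]
      = (\<beta> - \<alpha>) / (2 * real n + \<alpha> + \<beta> + 2) * jacobi_integral (\<alpha> + real n) (\<beta> + real n) 1"
    using ab jacobi_integral_X[of "\<alpha> + real n" "\<beta> + real n"] by (simp add: algebra_simps)
  finally show ?thesis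
    by (simp add: jacobi_sigma1_def mult.commute flip: jacobi_integral_div_gamma[OF ab])
qed

text \<open>This is Cauchy-Schwarz between the constant bound 2 on \<open>cheb_term k\<close> and
  the Jacobi polynomial. It is carried out pointwise, which keeps the majorant \<open>?q\<close> a
  polynomial with a known integral.\<close>

lemma abs_cheb_jacobi_coeff_le:
  "\<bar>cheb_jacobi_coeff \<alpha> \<beta> n k\<bar> \<le> 2 * sqrt (jacobi_gamma \<alpha> \<beta> 0 / jacobi_gamma \<alpha> \<beta> n)"
proof -
  let ?J = "jacobi_poly \<alpha> \<beta> n"
  define g0 gn where "g0 = jacobi_gamma \<alpha> \<beta> 0" and "gn = jacobi_gamma \<alpha> \<beta> n"
  have pos: "g0 > 0" "gn > 0" using jacobi_gamma_pos[OF ab] by (simp_all add: g0_def gn_def)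
  define t where "t = sqrt (gn / g0)"
  have t: "t > 0" "t * t = gn / g0" using pos by (simp_all add: t_def)
  have int: "set_integrable lborel {-1<..<1} (\<lambda>x. poly p x * jacobi_weight \<alpha> \<beta> x)" for p
    by (rule set_integrable_jacobi_weight_poly[OF ab])
  let ?q = "[:t:] + smult (1 / t) (?J * ?J)"
  have "\<bar>jacobi_integral \<alpha> \<beta> (cheb_term k * ?J)\<bar> \<le> jacobi_integral \<alpha> \<beta> ?q"
    unfolding jacobi_integral_def
  proof -
    have "\<bar>LINT x:{-1<..<1}|lborel. poly (cheb_term k * ?J) x * jacobi_weight \<alpha> \<beta> x\<bar>
        \<le> (LINT x:{-1<..<1}|lborel. \<bar>poly (cheb_term k * ?J) x * jacobi_weight \<alpha> \<beta> x\<bar>)"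
      using set_integral_norm_bound[OF int[of "cheb_term k * ?J"]] by simp
    also have "\<dots> \<le> (LINT x:{-1<..<1}|lborel. poly ?q x * jacobi_weight \<alpha> \<beta> x)"
    proof (rule set_integral_mono)
      show "set_integrable lborel {-1<..<1} (\<lambda>x. \<bar>poly (cheb_term k * ?J) x * jacobi_weight \<alpha> \<beta> x\<bar>)"
        by (rule set_integrable_abs[OF int])
      show "set_integrable lborel {-1<..<1} (\<lambda>x. poly ?q x * jacobi_weight \<alpha> \<beta> x)"
        by (rule int)
      fix x :: real assume x: "x \<in> {-1<..<1}"
      let ?j = "poly ?J x"
      \<comment> \<open>AM-GM with the weight \<open>t\<close> that equates both halves after integration\<close>
      have "2 * \<bar>?j\<bar> \<le> t + ?j * ?j / t"
        using sum_squares_bound[of "\<bar>?j\<bar>" t] t(1) by (simp add: field_simps power2_eq_square)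
      moreover have "\<bar>poly (cheb_term k) x\<bar> * \<bar>?j\<bar> \<le> 2 * \<bar>?j\<bar>"
        using abs_poly_cheb_term_le[of x k] x by (intro mult_right_mono) auto
      ultimately have "\<bar>poly (cheb_term k * ?J) x\<bar> \<le> poly ?q x"
        by (simp add: abs_mult)
      then show "\<bar>poly (cheb_term k * ?J) x * jacobi_weight \<alpha> \<beta> x\<bar> \<le> poly ?q x * jacobi_weight \<alpha> \<beta> x"
        using jacobi_weight_pos[OF x, of \<alpha> \<beta>] unfolding abs_mult by (intro mult_mono) auto
    qed
    finally show "\<bar>LINT x:{-1<..<1}|lborel. poly (cheb_term k * ?J) x * jacobi_weight \<alpha> \<beta> x\<bar>
        \<le> (LINT x:{-1<..<1}|lborel. poly ?q x * jacobi_weight \<alpha> \<beta> x)" .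
  qed
  also have "[:t:] = smult t 1" by (simp add: one_pCons)
  also have "jacobi_integral \<alpha> \<beta> (smult t 1 + smult (1 / t) (?J * ?J)) = t * g0 + gn / t"
    by (simp only: jacobi_integral_add[OF ab] jacobi_integral_smult jacobi_integral_square_jacobi_poly[OF ab]
      g0_def gn_def jacobi_gamma_0[OF ab]) simp
  finally have "\<bar>cheb_jacobi_coeff \<alpha> \<beta> n k\<bar> \<le> (t * g0 + gn / t) / gn"
    using pos(2) by (simp add: cheb_jacobi_coeff_def gn_def[symmetric] divide_right_mono)
  also have "t * g0 = gn / t" using t pos by (simp add: field_simps)
  also have "(gn / t + gn / t) / gn = 2 * (1 / t)" using pos by (simp add: field_simps)
  also have "1 / t = sqrt (g0 / gn)" by (simp add: t_def real_sqrt_divide)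
  finally show ?thesis by (simp add: g0_def gn_def)
qed

end

text \<open>The \<open>n\<close>-th derivative of \<open>cheb_term k\<close> has the parity of
  \<open>n + k\<close>; an odd polynomial integrates to 0 against the symmetric weight.\<close>

lemma cheb_jacobi_coeff_parity:
  assumes "\<alpha> > -1" "odd (n + k)"
  shows "cheb_jacobi_coeff \<alpha> \<alpha> n k = 0"
proof -
  have "smult ((- 1) ^ n) (pcompose ((pderiv ^^ n) (cheb_term k)) [:0, -1:])
      = smult ((- 1) ^ k) ((pderiv ^^ n) (cheb_term k))"
    by (simp only: higher_pderiv_pcompose_uminus[symmetric] pcompose_cheb_term higher_pderiv_smult)
  then have "pcompose ((pderiv ^^ n) (cheb_term k)) [:0, -1:] = - (pderiv ^^ n) (cheb_term k)"
    using assms(2) by (cases "even n") auto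
  then show ?thesis
    using assms by (simp add: cheb_jacobi_coeff_eq jacobi_integral_odd)
qed

subsection \<open>Chebyshev expansion of functions analytic in a Bernstein ellipse\<close>

definition joukowski :: "complex \<Rightarrow> complex" where
  "joukowski w = (w + inverse w) / 2"

lemma joukowski_cis: "joukowski (cis t) = of_real (cos t)"
  by (simp add: joukowski_def complex_eq_iff)

text \<open>The differences from the foci are \<open>(w - 1)^2 / (2 w)\<close> and
  \<open>(w + 1)^2 / (2 w)\<close>, so the parallelogram law leaves a function of
  \<open>cmod w\<close> alone.\<close>

lemma foci_distance_joukowski:
  assumes "w \<noteq> 0"
  shows "cmod (joukowski w - 1) + cmod (joukowski w + 1) = cmod w + 1 / cmod w"
proof -
  have "joukowski w - 1 = (w - 1)\<^sup>2 / (2 * w)" "joukowski w + 1 = (w + 1)\<^sup>2 / (2 * w)"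
    using assms by (simp_all add: joukowski_def field_simps power2_eq_square)
  then have "cmod (joukowski w - 1) + cmod (joukowski w + 1)
      = ((cmod (w - 1))\<^sup>2 + (cmod (w + 1))\<^sup>2) / (2 * cmod w)"
    by (simp add: norm_divide norm_mult norm_power add_divide_distrib)
  also have "(cmod (w - 1))\<^sup>2 + (cmod (w + 1))\<^sup>2 = 2 * (cmod w)\<^sup>2 + 2"
    unfolding cmod_power2 by (simp add: power2_eq_square algebra_simps)
  also have "(2 * (cmod w)\<^sup>2 + 2) / (2 * cmod w) = cmod w + 1 / cmod w"
    using assms by (simp add: field_simps power2_eq_square)
  finally show ?thesis .
qed

text \<open>The two preimages \<open>z + s\<close> and \<open>z - s\<close> are reciprocal, so one
  of them has modulus at least 1.\<close>

lemma joukowski_surj: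
  obtains w where "cmod w \<ge> 1" "joukowski w = z"
proof -
  define s where "s = csqrt (z\<^sup>2 - 1)"
  have "(z + s) * (z - s) = 1"
    using power2_csqrt[of "z\<^sup>2 - 1"] by (simp add: s_def algebra_simps power2_eq_square)
  then have i: "inverse (z + s) = z - s" "inverse (z - s) = z + s"
    by (auto simp: inverse_unique mult.commute)
  have j: "joukowski (z + s) = z" "joukowski (z - s) = z"
    by (simp_all add: joukowski_def i)
  have "cmod (z + s) * cmod (z - s) = 1"
    using \<open>(z + s) * (z - s) = 1\<close> by (metis norm_mult norm_one)
  then have "cmod (z + s) \<ge> 1 \<or> cmod (z - s) \<ge> 1"
    using mult_strict_mono'[of "cmod (z + s)" 1 "cmod (z - s)" 1] by fastforce
  then show ?thesis using j that by blast
qed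

lemma bernstein_ellipse_eq_image:
  assumes "\<rho> > 0"
  shows "bernstein_ellipse \<rho> = joukowski ` sphere 0 \<rho>"
proof -
  have "w \<in> sphere 0 \<rho> \<longleftrightarrow> (\<exists>\<theta>\<in>{0..2 * pi}. w = of_real \<rho> * exp (\<i> * of_real \<theta>))" for w
  proof
    assume "w \<in> sphere 0 \<rho>"
    then have "w = of_real \<rho> * exp (\<i> * of_real (Arg2pi w))"
      using Arg2pi_eq[of w] assms by simp
    then show "\<exists>\<theta>\<in>{0..2 * pi}. w = of_real \<rho> * exp (\<i> * of_real \<theta>)"
      using Arg2pi_ge_0[of w] Arg2pi_lt_2pi[of w] by (intro bexI[of _ "Arg2pi w"]) auto
  qed (use assms in \<open>auto simp: norm_mult\<close>)
  then show ?thesis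
    unfolding bernstein_ellipse_def joukowski_def by blast
qed

text \<open>For the converse inclusion a preimage with modulus at least 1 is chosen:
  \<open>r + 1/r\<close> is injective for \<open>r \<ge> 1\<close>, so the focal sum determines the
  modulus.\<close>

lemma bernstein_ellipse_eq_foci:
  assumes "\<rho> > 1"
  shows "bernstein_ellipse \<rho> = {z. cmod (z - 1) + cmod (z + 1) = \<rho> + 1 / \<rho>}"
proof (intro set_eqI iffI)
  fix z assume "z \<in> bernstein_ellipse \<rho>"
  then obtain w where "cmod w = \<rho>" "z = joukowski w"
    using assms by (auto simp: bernstein_ellipse_eq_image)
  moreover have "w \<noteq> 0" using \<open>cmod w = \<rho>\<close> assms by auto
  ultimately show "z \<in> {z. cmod (z - 1) + cmod (z + 1) = \<rho> + 1 / \<rho>}"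
    using foci_distance_joukowski[of w] by simp
next
  fix z assume z: "z \<in> {z. cmod (z - 1) + cmod (z + 1) = \<rho> + 1 / \<rho>}"
  obtain w where w: "cmod w \<ge> 1" "joukowski w = z"
    by (rule joukowski_surj)
  have "w \<noteq> 0" using w(1) by auto
  then have "cmod w + 1 / cmod w = \<rho> + 1 / \<rho>"
    using foci_distance_joukowski[of w] w(2) z by auto
  then have "(cmod w - \<rho>) * (cmod w * \<rho> - 1) = 0"
    using w(1) \<open>w \<noteq> 0\<close> assms by (simp add: field_simps)
  moreover have "1 < cmod w * \<rho>"
    by (rule less_le_trans[OF assms]) (use w(1) assms in simp)
  ultimately have "cmod w = \<rho>" by simp
  then show "z \<in> bernstein_ellipse \<rho>"
    using w assms by (auto simp: bernstein_ellipse_eq_image)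
qed

text \<open>The ellipse is the level set \<open>S z = c\<close> of the focal sum. A connected set
  that avoids it and starts below \<open>c\<close> stays below \<open>c\<close>, and the sublevel
  set is bounded because \<open>S\<close> dominates the distance to 1.\<close>

lemma joukowski_annulus_subset:
  assumes "\<rho> > 1" "1 \<le> cmod w" "cmod w \<le> \<rho>"
  shows "joukowski w \<in> bernstein_ellipse \<rho> \<union> inside (bernstein_ellipse \<rho>)"
proof (cases "cmod w = \<rho>")
  case True
  then show ?thesis using assms by (auto simp: bernstein_ellipse_eq_image)
next
  case False
  define S where "S = (\<lambda>z. cmod (z - 1) + cmod (z + 1))"
  define c where "c = \<rho> + 1 / \<rho>"
  let ?z = "joukowski w"
  let ?C = "connected_component_set (- bernstein_ellipse \<rho>) ?z"
  have w: "w \<noteq> 0" "cmod w < \<rho>" using assms False by auto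
  have "1 < cmod w * \<rho>"
    by (rule less_le_trans[OF assms(1)]) (use assms in simp)
  \<comment> \<open>This product is \<open>\<rho> * cmod w\<close> times the gap between
    \<open>c\<close> and \<open>cmod w + 1 / cmod w\<close>.\<close>
  then have "(\<rho> - cmod w) * (cmod w * \<rho> - 1) > 0"
    using w by (intro mult_pos_pos) auto
  then have "cmod w + 1 / cmod w < c"
    using w assms by (simp add: c_def field_simps)
  then have Sz: "S ?z < c"
    using foci_distance_joukowski[OF w(1)] by (simp add: S_def)
  have E: "z \<in> bernstein_ellipse \<rho> \<longleftrightarrow> S z = c" for z
    using assms(1) by (simp add: bernstein_ellipse_eq_foci S_def c_def)
  have z: "?z \<notin> bernstein_ellipse \<rho>" using Sz by (simp add: E)
  have "S y < c" if "y \<in> ?C" for y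
  proof (rule ccontr)
    assume "\<not> S y < c"
    have "connected (S ` ?C)"
      unfolding S_def by (intro connected_continuous_image continuous_intros) auto
    moreover have "S y \<in> S ` ?C" "S ?z \<in> S ` ?C"
      using that z by (auto simp: connected_component_refl_eq)
    ultimately have "c \<in> S ` ?C"
      using Sz \<open>\<not> S y < c\<close> connectedD_interval[of "S ` ?C" "S ?z" "S y" c] by force
    moreover have "?C \<subseteq> - bernstein_ellipse \<rho>"
      by (rule connected_component_subset)
    ultimately show False using E by auto
  qed
  moreover have "dist 1 y \<le> S y" for y
    by (simp add: S_def dist_norm norm_minus_commute)
  ultimately have "?C \<subseteq> cball 1 c"
    by (meson less_imp_le mem_cball order_trans subsetI)
  then have "bounded ?C"
    using bounded_cball bounded_subset by blast
  then show ?thesis using z by (simp add: inside_def)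
qed

text \<open>\<open>(1 - 1 / w^2) / 2\<close> is the derivative of \<open>joukowski\<close>, and the
  denominator factors as \<open>(w - e) (w - 1/e) / (2 w)\<close>; the quotient is therefore a
  logarithmic derivative and splits into simple fractions.\<close>

lemma joukowski_kernel:
  assumes "w \<noteq> 0" "e \<noteq> 0" "w \<noteq> e" "w \<noteq> inverse e"
  shows "joukowski w \<noteq> joukowski e"
    and "(1 - 1 / w\<^sup>2) / 2 / (joukowski w - joukowski e) = 1 / (w - e) + 1 / (w - inverse e) - 1 / w"
proof -
  have d: "joukowski w - joukowski e = (w - e) * (w - inverse e) / (2 * w)"
    using assms by (simp add: joukowski_def field_simps)
  have nz: "w - e \<noteq> 0" "w - inverse e \<noteq> 0" using assms by auto
  have "joukowski w - joukowski e \<noteq> 0"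
    unfolding d using nz assms(1) by simp
  then show "joukowski w \<noteq> joukowski e" by auto
  have e: "e * inverse e = 1" using assms by simp
  define f where "f = inverse e"
  have "(1 - 1 / w\<^sup>2) / 2 / ((w - e) * (w - f) / (2 * w)) = (w\<^sup>2 - 1) / (w * ((w - e) * (w - f)))"
  proof -
    have "(1 - 1 / w\<^sup>2) / 2 / (p / (2 * w)) = (w\<^sup>2 - 1) / (w * p)" if "p \<noteq> 0" for p
      using assms(1) that by (simp add: field_simps power2_eq_square)
    then show ?thesis using nz[folded f_def] by simp
  qed
  also have "w\<^sup>2 - 1 = w * (w - f) + w * (w - e) - (w - e) * (w - f)"
    using e[folded f_def] by (simp add: algebra_simps power2_eq_square)
  also have "\<dots> / (w * ((w - e) * (w - f))) = 1 / (w - e) + 1 / (w - f) - 1 / w"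
  proof -
    have "(w * q + w * p - p * q) / (w * (p * q)) = 1 / p + 1 / q - 1 / w" if "p \<noteq> 0" "q \<noteq> 0" for p q
      using assms(1) that by (simp add: diff_divide_distrib add_divide_distrib)
    then show ?thesis using nz[folded f_def] by simp
  qed
  finally show "(1 - 1 / w\<^sup>2) / 2 / (joukowski w - joukowski e) = 1 / (w - e) + 1 / (w - inverse e) - 1 / w"
    by (simp add: d f_def)
qed

text \<open>With \<open>w = e\<^sup>i\<^sup>t\<close> the integrand becomes \<open>- F (cos t) sin t\<close>, which is odd about \<open>t = \<pi>\<close>; no
  regularity of \<open>F\<close> is involved because \<open>integral\<close> is 0 for non-integrable functions.\<close>

lemma contour_integral_unit_circle_joukowski:
  "contour_integral (circlepath 0 1) (\<lambda>w. F (joukowski w) * ((1 - 1 / w\<^sup>2) / 2)) = 0"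
proof -
  define h where "h = (\<lambda>t. - (F (of_real (cos t)) * of_real (sin t)))"
  have h: "F (joukowski (cis t)) * ((1 - 1 / (cis t)\<^sup>2) / 2) * \<i> * cis t = h t" for t
  proof -
    have "(1 - 1 / (cis t)\<^sup>2) / 2 * \<i> * cis t = \<i> * (cis t - inverse (cis t)) / 2"
      by (simp add: field_simps power2_eq_square)
    also have "\<dots> = - of_real (sin t)"
      by (simp add: complex_eq_iff)
    finally show ?thesis
      by (simp add: joukowski_cis h_def mult.assoc)
  qed
  have I: "contour_integral (circlepath 0 1) (\<lambda>w. F (joukowski w) * ((1 - 1 / w\<^sup>2) / 2)) = integral {0..2 * pi} h"
    unfolding circlepath_def h[symmetric, abs_def] by (subst contour_integral_part_circlepath_eq) simp_all
  have h2: "h (2 * pi - t) = - h t" for t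
    by (simp add: h_def sin_diff cos_diff)
  have "integral {0..2 * pi} h = 0"
  proof (cases "h integrable_on {0..2 * pi}")
    case True
    then have "(h has_integral integral {0..2 * pi} h) (cbox 0 (2 * pi))"
      by (simp add: has_integral_integral)
    from has_integral_affinity[OF this, of "-1" "2 * pi"]
    have "((\<lambda>t. h (2 * pi - t)) has_integral integral {0..2 * pi} h) ((\<lambda>x. 2 * pi - x) ` {0..2 * pi})"
      by simp
    also have "(\<lambda>x. 2 * pi - x) ` {0..2 * pi} = {0..2 * pi}"
      using image_affinity_atLeastAtMost_diff by simp
    finally have "((\<lambda>t. - h t) has_integral integral {0..2 * pi} h) {0..2 * pi}"
      by (simp add: h2)
    moreover have "((\<lambda>t. - h t) has_integral - integral {0..2 * pi} h) {0..2 * pi}"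
      using True by (intro has_integral_neg) (simp add: has_integral_integral)
    ultimately have "integral {0..2 * pi} h = - integral {0..2 * pi} h"
      by (rule has_integral_unique)
    then show ?thesis by simp
  qed (rule not_integrable_integral)
  with I show ?thesis by simp
qed

text \<open>The straight-line homotopy moves along radii and stays in the annulus.\<close>

lemma homotopic_circlepaths:
  assumes "0 < r" "r \<le> s" "\<And>w. r \<le> cmod w \<Longrightarrow> cmod w \<le> s \<Longrightarrow> w \<in> A"
  shows "homotopic_loops A (circlepath 0 r) (circlepath 0 s)"
proof (rule homotopic_loops_linear)
  fix t assume "t \<in> {0..1::real}"
  define c where "c = exp (2 * of_real pi * \<i> * of_real t)"
  have c: "cmod c = 1" by (simp add: c_def)
  show "closed_segment (circlepath 0 r t) (circlepath 0 s t) \<subseteq> A"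
  proof
    fix w assume "w \<in> closed_segment (circlepath 0 r t) (circlepath 0 s t)"
    then obtain v where v: "0 \<le> v" "v \<le> 1" "w = (1 - v) *\<^sub>R (of_real r * c) + v *\<^sub>R (of_real s * c)"
      by (auto simp: closed_segment_def circlepath c_def)
    then have "w = of_real ((1 - v) * r + v * s) * c"
      by (simp add: scaleR_conv_of_real algebra_simps)
    then have "cmod w = \<bar>(1 - v) * r + v * s\<bar>"
      by (simp only: norm_mult c norm_of_real) simp
    moreover have "(1 - v) * r + v * s = r + v * (s - r)" "(1 - v) * r + v * s = s - (1 - v) * (s - r)"
      by (simp_all add: algebra_simps)
    moreover have "v * (s - r) \<ge> 0" "(1 - v) * (s - r) \<ge> 0"
      using v assms by auto
    ultimately have "r \<le> cmod w" "cmod w \<le> s" using assms(1) by auto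
    then show "w \<in> A" by (rule assms(3))
  qed
qed auto

text \<open>The difference quotient \<open>F\<close> of \<open>u\<close> at \<open>cos t\<close> is
  holomorphic, so its integral over \<open>\<bar>w\<bar> = \<rho>\<close> can be moved to \<open>\<bar>w\<bar> = 1\<close>, where it vanishes.\<close>

lemma joukowski_cauchy_integral:
  fixes t :: real
  assumes "\<rho> > 1" "u \<in> bernstein_analytic \<rho>"
  defines "e \<equiv> cis t"
  shows "((\<lambda>w. u (joukowski w) * (1 / (w - e) + 1 / (w - cnj e) - 1 / w))
           has_contour_integral 2 * of_real pi * \<i> * u (of_real (cos t))) (circlepath 0 \<rho>)"
proof -
  define x where "x = complex_of_real (cos t)"
  obtain T where T: "open T" "bernstein_ellipse \<rho> \<union> inside (bernstein_ellipse \<rho>) \<subseteq> T" "u holomorphic_on T"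
    using assms(2) by (auto simp: bernstein_analytic_def analytic_on_holomorphic)
  \<comment> \<open>Filling the removable singularity with the derivative keeps the quotient
    holomorphic across \<open>x\<close>, which lies on the image of the unit circle.\<close>
  define F where "F = (\<lambda>z. if z = x then deriv u x else (u z - u x) / (z - x))"
  have F: "F holomorphic_on T"
    unfolding F_def by (rule pole_lemma_open[OF T(3,1)])
  define A where "A = {w. w \<noteq> 0 \<and> joukowski w \<in> T}"
  have J: "joukowski holomorphic_on - {0}"
    unfolding joukowski_def by (intro holomorphic_intros) auto
  have "open A"
  proof -
    have "A = (- {0}) \<inter> joukowski -` T" by (auto simp: A_def)
    then show ?thesis
      using continuous_open_preimage[OF holomorphic_on_imp_continuous_on[OF J] _ T(1)] by auto
  qed
  define G where "G = (\<lambda>w. F (joukowski w) * ((1 - 1 / w\<^sup>2) / 2))"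
  have "(F \<circ> joukowski) holomorphic_on A"
    by (intro holomorphic_on_compose_gen[OF holomorphic_on_subset[OF J] F]) (auto simp: A_def)
  then have G: "G holomorphic_on A"
    unfolding G_def o_def by (intro holomorphic_intros) (auto simp: A_def)
  have ann: "w \<in> A" if "1 \<le> cmod w" "cmod w \<le> \<rho>" for w
    using joukowski_annulus_subset[OF assms(1) that] T(2) that by (auto simp: A_def)
  have hom: "homotopic_loops A (circlepath 0 1) (circlepath 0 \<rho>)"
    by (rule homotopic_circlepaths) (use assms(1) ann in auto)
  have "contour_integral (circlepath 0 1) G = contour_integral (circlepath 0 \<rho>) G"
    by (rule Cauchy_theorem_homotopic_loops[OF hom \<open>open A\<close> G]) auto
  moreover have "G contour_integrable_on circlepath 0 \<rho>"
    using G ann assms(1) by (intro contour_integrable_holomorphic_simple[OF G \<open>open A\<close>]) auto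
  ultimately have G0: "(G has_contour_integral 0) (circlepath 0 \<rho>)"
    using contour_integral_unit_circle_joukowski[of F] has_contour_integral_integral
    unfolding G_def by metis
  have e: "cmod e = 1" "cnj e = inverse e" "e \<noteq> 0" "joukowski e = x"
    by (simp_all add: e_def cis_cnj joukowski_cis x_def)
  have C: "((\<lambda>w. 1 / (w - a)) has_contour_integral 2 * of_real pi * \<i> * 1) (circlepath 0 \<rho>)"
    if "cmod a < \<rho>" for a
    using that by (intro Cauchy_integral_circlepath_simple) auto
  \<comment> \<open>The poles \<open>e\<close>, \<open>cnj e\<close> and 0 lie inside the circle of
    radius \<open>\<rho>\<close>; their residues 1, 1 and -1 add up to 1.\<close>
  have K: "((\<lambda>w. u x * (1 / (w - e) + 1 / (w - cnj e) - 1 / (w - 0))) has_contour_integral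
      u x * (2 * of_real pi * \<i> * 1 + 2 * of_real pi * \<i> * 1 - 2 * of_real pi * \<i> * 1)) (circlepath 0 \<rho>)"
    by (intro has_contour_integral_lmul has_contour_integral_diff has_contour_integral_add C)
       (use e assms(1) in \<open>auto simp: norm_inverse\<close>)
  have "((\<lambda>w. G w + u x * (1 / (w - e) + 1 / (w - cnj e) - 1 / (w - 0))) has_contour_integral
      0 + u x * (2 * of_real pi * \<i> * 1 + 2 * of_real pi * \<i> * 1 - 2 * of_real pi * \<i> * 1)) (circlepath 0 \<rho>)"
    by (rule has_contour_integral_add[OF G0 K])
  then have "((\<lambda>w. G w + u x * (1 / (w - e) + 1 / (w - cnj e) - 1 / (w - 0))) has_contour_integral
      2 * of_real pi * \<i> * u (of_real (cos t))) (circlepath 0 \<rho>)"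
    by (simp add: x_def mult_ac)
  then show ?thesis
  proof (rule has_contour_integral_eq)
    fix w assume "w \<in> path_image (circlepath 0 \<rho>)"
    then have w: "cmod w = \<rho>" using assms(1) by simp
    have ne: "w \<noteq> 0" "w \<noteq> e" "w \<noteq> inverse e"
      using w e assms(1) by (auto simp: norm_inverse)
    note k = joukowski_kernel[OF ne(1) e(3) ne(2,3), unfolded e(4)]
    \<comment> \<open>On this circle \<open>joukowski w\<close> differs from \<open>x\<close>, so
      \<open>F\<close> is the plain difference quotient and the terms with \<open>u x\<close>
      cancel.\<close>
    have "G w = (u (joukowski w) - u x) * ((1 - 1 / w\<^sup>2) / 2 / (joukowski w - x))"
      using k(1) by (simp add: G_def F_def)
    then show "G w + u x * (1 / (w - e) + 1 / (w - cnj e) - 1 / (w - 0))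
        = u (joukowski w) * (1 / (w - e) + 1 / (w - cnj e) - 1 / w)"
      by (simp only: k(2) e(2) diff_zero left_diff_distrib diff_add_cancel)
  qed
qed

text \<open>\<open>a k\<close> is a Laurent coefficient of \<open>u (joukowski w)\<close>, and the
  standard estimate on the circle of radius \<open>\<rho>\<close> gives its decay. The series arises
  by expanding the Cauchy kernel geometrically in \<open>1/w\<close> and integrating term by
  term.\<close>

lemma chebyshev_expansion:
  assumes "\<rho> > 1" "u \<in> bernstein_analytic \<rho>"
    and M: "M = (SUP z\<in>bernstein_ellipse \<rho>. cmod (u z))"
  obtains a where "\<And>k. cmod (a k) \<le> M / \<rho> ^ k"
    and "\<And>x. x \<in> {-1..1} \<Longrightarrow> (\<lambda>k. a k * of_real (poly (cheb_term k) x)) sums u (of_real x)"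
proof -
  let ?P = "circlepath 0 \<rho>"
  define g where "g = (\<lambda>w. u (joukowski w))"
  define a where "a = (\<lambda>k. contour_integral ?P (\<lambda>w. g w / w ^ Suc k) / (2 * of_real pi * \<i>))"
  have E: "bernstein_ellipse \<rho> = joukowski ` sphere 0 \<rho>"
    using assms(1) by (intro bernstein_ellipse_eq_image) auto
  have contJ: "continuous_on (sphere 0 \<rho>) joukowski"
    unfolding joukowski_def using assms(1) by (intro continuous_intros) auto
  have contu: "continuous_on (bernstein_ellipse \<rho>) u"
    using assms(2) unfolding bernstein_analytic_def
    by (intro holomorphic_on_imp_continuous_on analytic_imp_holomorphic) (simp add: analytic_on_Un)
  have contg: "continuous_on (sphere 0 \<rho>) g"
    unfolding g_def using continuous_on_compose2[OF contu contJ] E by auto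
  have "compact ((\<lambda>z. cmod (u z)) ` bernstein_ellipse \<rho>)"
    unfolding E by (intro compact_continuous_image continuous_on_norm contu[unfolded E] contJ) auto
  \<comment> \<open>The supremum \<open>M\<close> is an upper bound only once the set is known to be
    bounded above; compactness of the ellipse supplies that.\<close>
  then have bdd: "bdd_above ((\<lambda>z. cmod (u z)) ` bernstein_ellipse \<rho>)"
    by (intro bounded_imp_bdd_above compact_imp_bounded)
  have gM: "cmod (g w) \<le> M" if "cmod w = \<rho>" for w
    unfolding M g_def using that by (intro cSUP_upper[OF _ bdd]) (auto simp: E)
  have "M \<ge> 0"
    by (rule order_trans[OF norm_ge_zero gM[of "of_real \<rho>"]]) (use assms(1) in simp)
  have int: "(\<lambda>w. g w / w ^ Suc k) contour_integrable_on ?P" for k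
    using assms(1) contg by (intro contour_integrable_continuous_circlepath continuous_intros) auto
  have bound: "cmod (a k) \<le> M / \<rho> ^ k" for k
  proof -
    have "cmod (contour_integral ?P (\<lambda>w. g w / w ^ Suc k)) \<le> M / \<rho> ^ Suc k * (2 * pi * \<rho>)"
    proof (rule has_contour_integral_bound_circlepath)
      show "((\<lambda>w. g w / w ^ Suc k) has_contour_integral contour_integral ?P (\<lambda>w. g w / w ^ Suc k)) ?P"
        by (rule has_contour_integral_integral[OF int])
      show "cmod (g w / w ^ Suc k) \<le> M / \<rho> ^ Suc k" if "cmod (w - 0) = \<rho>" for w
        using gM[of w] that assms(1) by (simp add: norm_divide norm_mult norm_power divide_right_mono)
    qed (use assms(1) \<open>M \<ge> 0\<close> in auto)
    also have "\<dots> = M / \<rho> ^ k * (2 * pi)"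
      using assms(1) by simp
    finally show ?thesis
      by (simp add: a_def norm_divide norm_mult field_simps)
  qed
  have "(\<lambda>k. a k * of_real (poly (cheb_term k) x)) sums u (of_real x)" if x: "x \<in> {-1..1}" for x
  proof -
    define t where "t = arccos x"
    have t: "cos t = x" using x by (simp add: t_def)
    define e where "e = cis t"
    have e: "cmod e = 1" "cmod (cnj e) = 1" by (simp_all add: e_def)
    define c where "c = (\<lambda>k. complex_of_real (poly (cheb_term k) x))"
    define f where "f = (\<lambda>k w. c k * (g w / w ^ Suc k))"
    define K where "K = (\<lambda>w. g w * (1 / (w - e) + 1 / (w - cnj e) - 1 / w))"
    have geom: "(\<lambda>k. b ^ k / w ^ Suc k) sums (1 / (w - b))" if "cmod b = 1" "cmod w = \<rho>" for b w
    proof -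
      have "cmod (b / w) < 1" "w \<noteq> 0" "w \<noteq> b" using that assms(1) by (auto simp: norm_divide)
      then have "(\<lambda>k. 1 / w * (b / w) ^ k) sums (1 / w * (1 / (1 - b / w)))"
        by (intro sums_mult geometric_sums)
      moreover have "1 / w * (1 / (1 - b / w)) = 1 / (w - b)"
        using \<open>w \<noteq> 0\<close> \<open>w \<noteq> b\<close> by (simp add: field_simps)
      ultimately show ?thesis by (simp add: power_divide)
    qed
    have c: "c k = e ^ k + cnj e ^ k - (if k = 0 then 1 else 0)" for k
      unfolding c_def e_def t[symmetric] by (rule poly_cheb_term_cos)
    have fK: "(\<lambda>k. f k w) sums K w" if w: "cmod w = \<rho>" for w
    proof -
      \<comment> \<open>The kernel term \<open>- 1 / w\<close> enters at \<open>k = 0\<close> only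
        and matches the correction in \<open>c 0\<close>.\<close>
      have "(\<lambda>k. if k = 0 then 1 / w else 0) sums (1 / w)"
        using sums_single[of 0 "\<lambda>_. 1 / w"] by simp
      then have "(\<lambda>k. g w * (e ^ k / w ^ Suc k + cnj e ^ k / w ^ Suc k - (if k = 0 then 1 / w else 0))) sums K w"
        unfolding K_def by (intro sums_mult sums_diff sums_add geom w e)
      moreover have "g w * (e ^ k / w ^ Suc k + cnj e ^ k / w ^ Suc k - (if k = 0 then 1 / w else 0)) = f k w" for k
      proof -
        have "(if k = 0 then 1 / w else 0) = (if k = 0 then 1 else 0) / w ^ Suc k"
          by simp
        then show ?thesis
          unfolding f_def c by (simp only: add_divide_distrib[symmetric] diff_divide_distrib[symmetric]) simp
      qed
      ultimately show ?thesis by simp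
    qed
    have fb: "cmod (f k w) \<le> 2 * M / \<rho> * (1 / \<rho>) ^ k" if "w \<in> sphere 0 \<rho>" for k w
    proof -
      have "cmod (f k w) = cmod (c k) * cmod (g w) / \<rho> ^ Suc k"
        using that by (simp add: f_def norm_mult norm_divide norm_power)
      also have "\<dots> \<le> 2 * M / \<rho> ^ Suc k"
        using gM[of w] that abs_poly_cheb_term_le[OF x, of k] assms(1)
        by (intro divide_right_mono mult_mono) (auto simp: c_def)
      finally show ?thesis by (simp add: power_divide)
    qed
    \<comment> \<open>A geometric majorant uniform on the circle permits exchanging the sum with the
      contour integral.\<close>
    have "summable (\<lambda>k. 2 * M / \<rho> * (1 / \<rho>) ^ k)"
      using assms(1) by (intro summable_mult summable_geometric) auto
    then have "uniform_limit (sphere 0 \<rho>) (\<lambda>n w. \<Sum>k<n. f k w) (\<lambda>w. \<Sum>k. f k w) sequentially"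
      using fb by (intro Weierstrass_m_test)
    also have "?this \<longleftrightarrow> uniform_limit (sphere 0 \<rho>) (\<lambda>n w. \<Sum>k<n. f k w) K sequentially"
      using fK by (intro uniform_limit_cong') (auto simp: sums_iff)
    finally have ul: "uniform_limit (sphere 0 \<rho>) (\<lambda>n w. \<Sum>k<n. f k w) K sequentially" .
    have intf: "f k contour_integrable_on ?P" for k
      unfolding f_def by (intro contour_integrable_lmul int)
    have "(\<lambda>n. contour_integral ?P (\<lambda>w. \<Sum>k<n. f k w)) \<longlonglongrightarrow> contour_integral ?P K"
      using assms(1) by (intro contour_integral_uniform_limit_circlepath(2)[OF _ ul] always_eventually allI
        contour_integrable_sum intf) auto
    also have "(\<lambda>n. contour_integral ?P (\<lambda>w. \<Sum>k<n. f k w)) = (\<lambda>n. \<Sum>k<n. contour_integral ?P (f k))"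
      by (intro ext contour_integral_sum intf) auto
    also have "contour_integral ?P K = 2 * of_real pi * \<i> * u (of_real x)"
      using joukowski_cauchy_integral[OF assms(1,2), of t]
      unfolding t K_def e_def g_def by (rule contour_integral_unique)
    finally have "(\<lambda>k. contour_integral ?P (f k)) sums (2 * of_real pi * \<i> * u (of_real x))"
      by (simp add: sums_def)
    from sums_divide[OF this, of "2 * of_real pi * \<i>"]
    have "(\<lambda>k. contour_integral ?P (f k) / (2 * of_real pi * \<i>)) sums u (of_real x)"
      by simp
    moreover have "contour_integral ?P (f k) / (2 * of_real pi * \<i>) = a k * c k" for k
      unfolding f_def by (subst contour_integral_lmul[OF int]) (simp add: a_def)
    ultimately show ?thesis by (simp add: c_def)
  qed
  with bound show ?thesis by (rule that)
qed

subsection \<open>Bounds on the Jacobi coefficients\<close>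

text \<open>The series is integrated term by term: decay of \<open>a k\<close> and the bound 2 on
  \<open>cheb_term k\<close> dominate the terms by a geometric sequence times one fixed integrable
  function.\<close>

lemma jacobi_coeff_sums:
  assumes ab: "\<alpha> > -1" "\<beta> > -1" and "\<rho> > 1"
    and a: "\<And>k. cmod (a k) \<le> M / \<rho> ^ k"
    and u: "\<And>x. x \<in> {-1..1} \<Longrightarrow> (\<lambda>k. a k * of_real (poly (cheb_term k) x)) sums u (of_real x)"
  shows "(\<lambda>k. a k * of_real (cheb_jacobi_coeff \<alpha> \<beta> n k)) sums jacobi_coeff \<alpha> \<beta> u n"
proof -
  let ?J = "jacobi_poly \<alpha> \<beta> n"
  define g where "g = (\<lambda>x. indicator {-1<..<1} x *\<^sub>R (poly ?J x * jacobi_weight \<alpha> \<beta> x))"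
  define f where "f = (\<lambda>k x. a k * complex_of_real (indicator {-1<..<1} x *\<^sub>R (poly (cheb_term k * ?J) x * jacobi_weight \<alpha> \<beta> x)))"
  have int: "integrable lborel (\<lambda>x. indicator {-1<..<1} x *\<^sub>R (poly p x * jacobi_weight \<alpha> \<beta> x))" for p
    using set_integrable_jacobi_weight_poly[OF ab, of p] by (simp add: set_integrable_def)
  have intf: "integrable lborel (f k)" for k
    unfolding f_def by (intro integrable_mult_right integrable_of_real int)
  have intg: "integrable lborel (\<lambda>x. norm (g x))"
    unfolding g_def by (intro integrable_norm int)
  have fg: "norm (f k x) \<le> 2 * M * (1 / \<rho>) ^ k * norm (g x)" for k x
  proof (cases "x \<in> {-1<..<1}")
    case True
    have "norm (f k x) = cmod (a k) * \<bar>poly (cheb_term k) x\<bar> * norm (g x)"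
      using True by (simp add: f_def g_def norm_mult abs_mult)
    also have "\<dots> \<le> (M / \<rho> ^ k) * 2 * norm (g x)"
      using True abs_poly_cheb_term_le[of x k] a[of k] order_trans[OF norm_ge_zero a[of k]]
      by (intro mult_mono mult_nonneg_nonneg) auto
    finally show ?thesis by (simp add: power_divide mult_ac)
  qed (simp add: f_def g_def)
  have summable_geo: "summable (\<lambda>k. 2 * M * (1 / \<rho>) ^ k * C)" for C
    using assms(3) by (intro summable_mult summable_mult2 summable_geometric) auto
  have 1: "AE x in lborel. summable (\<lambda>k. norm (f k x))"
    using fg by (intro AE_I2 summable_comparison_test'[OF summable_geo[of "norm (g _)"], of 0]) auto
  have "norm (LBINT x. norm (f k x)) \<le> 2 * M * (1 / \<rho>) ^ k * (LBINT x. norm (g x))" for k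
  proof -
    have "norm (LBINT x. norm (f k x)) = (LBINT x. norm (f k x))"
      by simp
    also have "\<dots> \<le> (LBINT x. 2 * M * (1 / \<rho>) ^ k * norm (g x))"
      by (intro integral_mono fg integrable_norm intf integrable_mult_right intg)
    finally show ?thesis by simp
  qed
  then have 2: "summable (\<lambda>k. LBINT x. norm (f k x))"
    by (intro summable_comparison_test'[OF summable_geo, of 0])
  have "(\<lambda>k. integral\<^sup>L lborel (f k)) sums (LBINT x. \<Sum>k. f k x)"
    by (rule sums_integral[OF intf 1 2])
  moreover have "integral\<^sup>L lborel (f k) = a k * of_real (jacobi_integral \<alpha> \<beta> (cheb_term k * ?J))" for k
    by (simp only: f_def integral_mult_right_zero integral_complex_of_real jacobi_integral_def set_lebesgue_integral_def)
  moreover have "(\<Sum>k. f k x) = indicator {-1<..<1} x *\<^sub>R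
      (u (of_real x) * of_real (poly ?J x) * of_real (jacobi_weight \<alpha> \<beta> x))" for x
  proof (cases "x \<in> {-1<..<1}")
    case True
    then have "(\<lambda>k. a k * of_real (poly (cheb_term k) x) * (of_real (poly ?J x) * of_real (jacobi_weight \<alpha> \<beta> x)))
        sums (u (of_real x) * (of_real (poly ?J x) * of_real (jacobi_weight \<alpha> \<beta> x)))"
      by (intro sums_mult2 u) auto
    then show ?thesis
      using True by (simp add: f_def sums_iff mult.assoc)
  qed (simp add: f_def)
  ultimately have "(\<lambda>k. a k * of_real (jacobi_integral \<alpha> \<beta> (cheb_term k * ?J))) sums
      (LINT x:{-1<..<1}|lborel. u (of_real x) * of_real (poly ?J x) * of_real (jacobi_weight \<alpha> \<beta> x))"
    by (simp add: set_lebesgue_integral_def)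
  from sums_mult[OF this, of "1 / of_real (jacobi_gamma \<alpha> \<beta> n)"] show ?thesis
    by (simp add: jacobi_coeff_def cheb_jacobi_coeff_def)
qed

text \<open>The series is split at \<open>n + 2\<close>: terms below \<open>n\<close> vanish and the
  next two are explicit. The majorant \<open>b\<close> of the tail stays a parameter, so that
  general and symmetric weights share the argument.\<close>

lemma jacobi_coeff_bound:
  assumes ab: "\<alpha> > -1" "\<beta> > -1" and "\<rho> > 1" and u: "u \<in> bernstein_analytic \<rho>"
    and M: "M = (SUP z\<in>bernstein_ellipse \<rho>. cmod (u z))"
    and b: "\<And>i. \<bar>cheb_jacobi_coeff \<alpha> \<beta> n (n + 2 + i)\<bar> / \<rho> ^ (2 + i) \<le> b i" "b sums B"
  shows "cmod (jacobi_coeff \<alpha> \<beta> u n) \<le>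
    M / \<rho> ^ n * (\<bar>jacobi_sigma0 \<alpha> \<beta> n\<bar> + \<bar>jacobi_sigma1 \<alpha> \<beta> n\<bar> / \<rho> + B)"
proof -
  obtain a where a: "\<And>k. cmod (a k) \<le> M / \<rho> ^ k"
    "\<And>x. x \<in> {-1..1} \<Longrightarrow> (\<lambda>k. a k * of_real (poly (cheb_term k) x)) sums u (of_real x)"
    using chebyshev_expansion[OF assms(3) u M] by blast
  define d where "d = cheb_jacobi_coeff \<alpha> \<beta> n"
  define f where "f = (\<lambda>k. a k * of_real (d k))"
  have "M \<ge> 0" using order_trans[OF norm_ge_zero a(1)[of 0]] by simp
  have f: "f sums jacobi_coeff \<alpha> \<beta> u n"
    unfolding f_def d_def by (rule jacobi_coeff_sums[OF ab assms(3) a])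
  have fM: "cmod (f k) \<le> M / \<rho> ^ k * \<bar>d k\<bar>" for k
    using mult_right_mono[OF a(1)[of k], of "\<bar>d k\<bar>"] by (simp add: f_def norm_mult)
  have tail: "cmod (f (i + (n + 2))) \<le> M / \<rho> ^ n * b i" for i
  proof -
    have "cmod (f (i + (n + 2))) \<le> M / \<rho> ^ n * (\<bar>d (n + 2 + i)\<bar> / \<rho> ^ (2 + i))"
      using fM[of "n + 2 + i"] assms(3) by (simp add: power_add field_simps)
    also have "\<dots> \<le> M / \<rho> ^ n * b i"
      using b(1)[of i] \<open>M \<ge> 0\<close> assms(3) by (intro mult_left_mono) (auto simp: d_def)
    finally show ?thesis .
  qed
  have "(\<lambda>i. M / \<rho> ^ n * b i) sums (M / \<rho> ^ n * B)"
    by (intro sums_mult b(2))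
  then have S: "cmod (\<Sum>i. f (i + (n + 2))) \<le> M / \<rho> ^ n * B"
    using tail norm_suminf_le[of "\<lambda>i. f (i + (n + 2))" "\<lambda>i. M / \<rho> ^ n * b i"]
    by (simp add: sums_iff)
  have z: "f k = 0" if "k < n" for k
    using cheb_jacobi_coeff_less[OF ab that] by (simp add: f_def d_def)
  have "jacobi_coeff \<alpha> \<beta> u n = (\<Sum>i. f (i + (n + 2))) + (\<Sum>k<n + 2. f k)"
    using suminf_split_initial_segment[of f "n + 2"] f by (simp add: sums_iff)
  also have "(\<Sum>k<n + 2. f k) = f n + f (Suc n)"
    using z by simp
  finally have eq: "jacobi_coeff \<alpha> \<beta> u n = (\<Sum>i. f (i + (n + 2))) + (f n + f (Suc n))" .
  have "cmod (jacobi_coeff \<alpha> \<beta> u n) \<le> cmod (\<Sum>i. f (i + (n + 2))) + (cmod (f n) + cmod (f (Suc n)))"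
    unfolding eq using norm_triangle_ineq[of "\<Sum>i. f (i + (n + 2))" "f n + f (Suc n)"] norm_triangle_ineq[of "f n" "f (Suc n)"]
    by linarith
  also have "\<dots> \<le> M / \<rho> ^ n * B + (M / \<rho> ^ n * \<bar>d n\<bar> + M / \<rho> ^ Suc n * \<bar>d (Suc n)\<bar>)"
    by (intro add_mono S fM)
  also have "\<dots> = M / \<rho> ^ n * (\<bar>jacobi_sigma0 \<alpha> \<beta> n\<bar> + \<bar>jacobi_sigma1 \<alpha> \<beta> n\<bar> / \<rho> + B)"
    unfolding d_def cheb_jacobi_coeff_n[OF ab] cheb_jacobi_coeff_Suc[OF ab]
    using assms(3) by (simp add: field_simps)
  finally show ?thesis .
qed

theorem theorem2p1:
  fixes \<rho> \<alpha> \<beta> M :: real and u :: "complex \<Rightarrow> complex" and n :: nat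
  assumes "\<rho> > 1"
    and "u \<in> bernstein_analytic \<rho>"
    and "\<alpha> > -1" and "\<beta> > -1"
    and "M = (SUP z\<in>bernstein_ellipse \<rho>. cmod (u z))"
  shows "cmod (jacobi_coeff \<alpha> \<beta> u n) \<le>
           M / \<rho> ^ n * (\<bar>jacobi_sigma0 \<alpha> \<beta> n\<bar> + \<bar>jacobi_sigma1 \<alpha> \<beta> n\<bar> / \<rho>
             + 2 / (\<rho> * (\<rho> - 1)) * sqrt (jacobi_gamma \<alpha> \<beta> 0 / jacobi_gamma \<alpha> \<beta> n))
       \<and> (\<alpha> = \<beta> \<longrightarrow>
          cmod (jacobi_coeff \<alpha> \<alpha> u n) \<le>
            M / \<rho> ^ n * (\<bar>jacobi_sigma0 \<alpha> \<alpha> n\<bar>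
              + 2 / (\<rho>\<^sup>2 - 1) * sqrt (jacobi_gamma \<alpha> \<alpha> 0 / jacobi_gamma \<alpha> \<alpha> n)))"
proof (intro conjI impI)
  define s where "s = sqrt (jacobi_gamma \<alpha> \<beta> 0 / jacobi_gamma \<alpha> \<beta> n)"
  have d: "\<bar>cheb_jacobi_coeff \<alpha> \<beta> n (n + 2 + i)\<bar> / \<rho> ^ (2 + i) \<le> 2 * s / \<rho> ^ (2 + i)" for i
    using abs_cheb_jacobi_coeff_le[OF assms(3,4), of n "n + 2 + i"] assms(1)
    by (intro divide_right_mono) (auto simp: s_def)
  \<comment> \<open>The tail starts at distance 2 from \<open>n\<close>, hence the factor
    \<open>1 / \<rho>^2\<close> in front of a geometric series of ratio
    \<open>1 / \<rho>\<close>.\<close>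
  have "(\<lambda>i. 2 * s / \<rho>\<^sup>2 * (1 / \<rho>) ^ i) sums (2 * s / \<rho>\<^sup>2 * (1 / (1 - 1 / \<rho>)))"
    using assms(1) by (intro sums_mult geometric_sums) auto
  also have "2 * s / \<rho>\<^sup>2 * (1 / (1 - 1 / \<rho>)) = 2 / (\<rho> * (\<rho> - 1)) * s"
    using assms(1) by (simp add: field_simps power2_eq_square)
  also have "(\<lambda>i. 2 * s / \<rho>\<^sup>2 * (1 / \<rho>) ^ i) = (\<lambda>i. 2 * s / \<rho> ^ (2 + i))"
    by (simp add: power_divide power_add power2_eq_square mult.assoc)
  finally have "(\<lambda>i. 2 * s / \<rho> ^ (2 + i)) sums (2 / (\<rho> * (\<rho> - 1)) * s)" .
  from jacobi_coeff_bound[OF assms(3,4,1,2,5) d this]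
  show "cmod (jacobi_coeff \<alpha> \<beta> u n) \<le>
           M / \<rho> ^ n * (\<bar>jacobi_sigma0 \<alpha> \<beta> n\<bar> + \<bar>jacobi_sigma1 \<alpha> \<beta> n\<bar> / \<rho>
             + 2 / (\<rho> * (\<rho> - 1)) * sqrt (jacobi_gamma \<alpha> \<beta> 0 / jacobi_gamma \<alpha> \<beta> n))"
    by (simp add: s_def)
  assume "\<alpha> = \<beta>"
  \<comment> \<open>By parity only even distances from \<open>n\<close> survive, which changes the
    ratio to \<open>1 / \<rho>^2\<close>.\<close>
  let ?b = "\<lambda>i. if even i then 2 * s / \<rho>\<^sup>2 * (1 / \<rho>\<^sup>2) ^ (i div 2) else 0"
  have d': "\<bar>cheb_jacobi_coeff \<alpha> \<alpha> n (n + 2 + i)\<bar> / \<rho> ^ (2 + i) \<le> ?b i" for i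
  proof (cases "even i")
    case True
    then obtain j where j: "i = 2 * j" by blast
    have "2 * s / \<rho>\<^sup>2 * (1 / \<rho>\<^sup>2) ^ (i div 2) = 2 * s / \<rho> ^ (2 + i)"
      by (simp add: j power_add power_mult power_divide power2_eq_square)
    then show ?thesis
      using d[of i] True \<open>\<alpha> = \<beta>\<close> by (simp only: if_True)
  next
    case False
    then show ?thesis by (simp add: cheb_jacobi_coeff_parity[OF assms(3)])
  qed
  have "(\<lambda>i. 2 * s / \<rho>\<^sup>2 * (1 / \<rho>\<^sup>2) ^ i) sums (2 * s / \<rho>\<^sup>2 * (1 / (1 - 1 / \<rho>\<^sup>2)))"
    using assms(1) by (intro sums_mult geometric_sums) (auto simp: power_gt1)
  \<comment> \<open>Interleaving with the zero series puts the terms at the even indices.\<close>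
  from sums_if[OF sums_zero this]
  have "?b sums (2 * s / \<rho>\<^sup>2 * (1 / (1 - 1 / \<rho>\<^sup>2)))"
    by simp
  also have "2 * s / \<rho>\<^sup>2 * (1 / (1 - 1 / \<rho>\<^sup>2)) = 2 / (\<rho>\<^sup>2 - 1) * s"
    using assms(1) power_gt1[of \<rho> 1] by (simp add: field_simps power2_eq_square)
  finally have "?b sums (2 / (\<rho>\<^sup>2 - 1) * s)" .
  \<comment> \<open>The middle term drops out because \<open>jacobi_sigma1\<close> carries the
    factor \<open>\<beta> - \<alpha>\<close>, here 0.\<close>
  from jacobi_coeff_bound[OF assms(3,3,1,2,5) d' this]
  show "cmod (jacobi_coeff \<alpha> \<alpha> u n) \<le>
            M / \<rho> ^ n * (\<bar>jacobi_sigma0 \<alpha> \<alpha> n\<bar>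
              + 2 / (\<rho>\<^sup>2 - 1) * sqrt (jacobi_gamma \<alpha> \<alpha> 0 / jacobi_gamma \<alpha> \<alpha> n))"
    using \<open>\<alpha> = \<beta>\<close> by (simp add: s_def jacobi_sigma1_def)
qed

end
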